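(* Let $(V,g)$ be a Euclidean real vector space of dimension $n$ and let $\omega$ be a symmetric $(2,2)$-double form on $V$ satisfying the first Bianchi identity. Then for every integer $p$ with $2\le p\le n-2$, the Weitzenböck transformation of order $p$ at $\omega$ is given by $$\mathcal N_p(\omega)=\left\{\frac{g\,c\omega}{p-1}-2\omega\right\}\frac{g^{p-2}}{(p-2)!},$$ where all products are products of double forms and $c$ is the contraction map.
   Context: Double forms. Let $(V,g)$ be a Euclidean real vector space of dimension $n$, with exterior algebra $\Lambda V=\bigoplus_p\Lambda^pV$ equipped with the usual inner product (for an orthonormal basis $(e_i)$ of $V$, the $e_{i_1}\wedge\dots\wedge e_{i_p}$, $i_1<\dots<i_p$, are orthonormal). A $(p,q)$-double form on $V$ is a bilinear form $\Lambda^pV\times\Lambda^qV\to\mathbb R$; for $p=q$ it is symmetric if the bilinear form is symmetric. The product of a $(p,q)$-double form $\omega_1$ and an $(r,s)$-double form $\omega_2$ is the $(p+r,q+s)$-double form $$\omega_1\omega_2(x_1\wedge\dots\wedge x_{p+r},y_1\wedge\dots\wedge y_{q+s})=\frac1{p!\,r!\,s!\,q!}\sum_{\sigma\in S_{p+r},\,\rho\in S_{q+s}}\epsilon(\sigma)\epsilon(\rho)\,\omega_1(x_{\sigma(1)}\wedge\dots\wedge x_{\sigma(p)},y_{\rho(1)}\wedge\dots\wedge y_{\rho(q)})\,\omega_2(x_{\sigma(p+1)}\wedge\dots\wedge x_{\sigma(p+r)},y_{\rho(q+1)}\wedge\dots\wedge y_{\rho(q+s)}).$$ The metric $g$ is a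 $(1,1)$-double form, and $g^k$ denotes its $k$-th power for this product, so $g^k(x_1\wedge\dots\wedge x_k,y_1\wedge\dots\wedge y_k)=k!\det[g(x_i,y_j)]$ and $g^0=1$. The contraction $c$ sends a $(p,p)$-double form $\omega$, $p\ge1$, to the $(p-1,p-1)$-double form $c\omega(x_1\wedge\dots\wedge x_{p-1},y_1\wedge\dots\wedge y_{p-1})=\sum_{j=1}^n\omega(e_j\wedge x_1\wedge\dots\wedge x_{p-1},e_j\wedge y_1\wedge\dots\wedge y_{p-1})$, with $(e_j)$ any orthonormal basis of $V$. A $(p,q)$-double form $\omega$ ($q\ge1$) satisfies the first Bianchi identity if for all vectors $x_i,y_j$: $\sum_{j=1}^{p+1}(-1)^j\omega(x_1\wedge\dots\wedge\hat x_j\wedge\dots\wedge x_{p+1},\,x_j\wedge y_1\wedge\dots\wedge y_{q-1})=0$, where the hat denotes omission. Weitzenböck transformation. The Clifford product on $\Lambda V$, denoted by a dot, is the associative bilinear unital product determined by $e.\psi=e\wedge\psi-i_e\psi$ for $e\in V$, $\psi\in\Lambda V$, where $i_e$ is the interior product (adjoint of exterior multiplication by $e$). For $\phi\in\Lambda V$ put $ad_\phi(\psi)=\phi.\psi-\psi.\phi$. For a symmetric $(2,2)$-double form $\omega$, the Weitzenböck transformation of order $p$ at $\omega$ is the symmetric $(p,p)$-double form $$\mathcal N_p(\omega)(\psi_1,\psi_2)=\frac14\sum_{i<j,\;k<l}\omega(e_i\wedge e_j,e_k\wedge e_l)\,\langle ad_{e_i.e_j}\psi_1,\,ad_{e_k.e_l}\psi_2\rangle,\qquad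 \psi_1,\psi_2\in\Lambda^pV,$$ where $(e_1,\dots,e_n)$ is any orthonormal basis of $V$ (the result is independent of this choice). *)

theory Defs
  imports "HOL-Analysis.Analysis" "HOL-Combinatorics.Permutations"
begin

section \<open>The exterior algebra of a Euclidean space\<close>

text \<open>The Euclidean space \<open>(V, g)\<close> is a type of class \<^class>\<open>euclidean_space\<close>: \<open>g\<close> is the
  inner product and \<open>n\<close> is \<open>DIM('a)\<close>.\<close>

text \<open>The library basis carries no order. An enumeration is chosen once and for all in order to
  write down coordinates on the exterior algebra; every later notion that depends on an orthonormal
  basis takes that basis as an argument.\<close>

definition ref_basis :: "nat \<Rightarrow> 'a::euclidean_space" where
  "ref_basis = (SOME b. bij_betw b {..<DIM('a)} Basis)"

text \<open>An element of \<open>\<Lambda>V\<close> is given by its coordinates: the value at \<open>S = {i\<^sub>1 < \<dots> < i\<^sub>p}\<close> is the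
  coefficient of \<open>b\<^sub>i\<^sub>1 \<and> \<dots> \<and> b\<^sub>i\<^sub>p\<close>, with \<open>b = ref_basis\<close>.\<close>

typedef (overloaded) ('a::euclidean_space) ext =
  "{f :: nat set \<Rightarrow> real. \<forall>S. \<not> S \<subseteq> {..<DIM('a)} \<longrightarrow> f S = 0}"
  morphisms ext_coeff Abs_ext
  by (rule exI[of _ "\<lambda>_. 0"]) simp

setup_lifting type_definition_ext

lemma ext_coeff_outside: "\<not> S \<subseteq> {..<DIM('a)} \<Longrightarrow> ext_coeff (\<psi> :: 'a::euclidean_space ext) S = 0"
  using ext_coeff[of \<psi>] by blast

lemma ext_eqI:
  fixes \<phi> \<psi> :: "'a::euclidean_space ext"
  assumes "\<And>S. S \<subseteq> {..<DIM('a)} \<Longrightarrow> ext_coeff \<phi> S = ext_coeff \<psi> S"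
  shows "\<phi> = \<psi>"
proof -
  have "ext_coeff \<phi> S = ext_coeff \<psi> S" for S
    using assms ext_coeff_outside[of S \<phi>] ext_coeff_outside[of S \<psi>]
    by (cases "S \<subseteq> {..<DIM('a)}") simp_all
  then have "ext_coeff \<phi> = ext_coeff \<psi>" by (rule HOL.ext)
  then show ?thesis by (simp only: ext_coeff_inject)
qed

instantiation ext :: (euclidean_space) real_vector
begin

lift_definition zero_ext :: "'a ext" is "\<lambda>S. 0" by simp
lift_definition plus_ext :: "'a ext \<Rightarrow> 'a ext \<Rightarrow> 'a ext" is "\<lambda>f h S. f S + h S" by simp
lift_definition minus_ext :: "'a ext \<Rightarrow> 'a ext \<Rightarrow> 'a ext" is "\<lambda>f h S. f S - h S" by simp
lift_definition uminus_ext :: "'a ext \<Rightarrow> 'a ext" is "\<lambda>f S. - f S" by simp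
lift_definition scaleR_ext :: "real \<Rightarrow> 'a ext \<Rightarrow> 'a ext" is "\<lambda>r f S. r * f S" by simp

instance
  by standard (transfer; auto simp: algebra_simps fun_eq_iff)+

end

text \<open>The sign with \<open>b\<^sub>A \<and> b\<^sub>B = shuffle_sign A B \<cdot> b\<^bsub>A \<union> B\<^esub>\<close> for disjoint \<open>A\<close> and \<open>B\<close>.\<close>

definition shuffle_sign :: "nat set \<Rightarrow> nat set \<Rightarrow> real" where
  "shuffle_sign A B = (- 1) ^ card {(a, b) \<in> A \<times> B. b < a}"

lemma shuffle_sign_empty [simp]: "shuffle_sign {} B = 1" "shuffle_sign A {} = 1"
  by (simp_all add: shuffle_sign_def)

lemma shuffle_sign_Un_left:
  assumes "finite A" "finite B" "finite C" "A \<inter> B = {}"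
  shows "shuffle_sign (A \<union> B) C = shuffle_sign A C * shuffle_sign B C"
proof -
  have fin: "finite {(a, b) \<in> X \<times> C. b < a}" if "finite X" for X :: "nat set"
    by (rule finite_subset[of _ "X \<times> C"]) (use that assms in auto)
  have "{(a, b) \<in> (A \<union> B) \<times> C. b < a} = {(a, b) \<in> A \<times> C. b < a} \<union> {(a, b) \<in> B \<times> C. b < a}"
    by auto
  moreover have "{(a, b) \<in> A \<times> C. b < a} \<inter> {(a, b) \<in> B \<times> C. b < a} = {}"
    using assms by auto
  ultimately show ?thesis
    using fin[OF assms(1)] fin[OF assms(2)]
    by (simp add: shuffle_sign_def card_Un_disjoint power_add)
qed

lemma shuffle_sign_Un_right:
  assumes "finite A" "finite B" "finite C" "B \<inter> C = {}"
  shows "shuffle_sign A (B \<union> C) = shuffle_sign A B * shuffle_sign A C"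
proof -
  have fin: "finite {(a, b) \<in> A \<times> X. b < a}" if "finite X" for X :: "nat set"
    by (rule finite_subset[of _ "A \<times> X"]) (use that assms in auto)
  have "{(a, b) \<in> A \<times> (B \<union> C). b < a} = {(a, b) \<in> A \<times> B. b < a} \<union> {(a, b) \<in> A \<times> C. b < a}"
    by auto
  moreover have "{(a, b) \<in> A \<times> B. b < a} \<inter> {(a, b) \<in> A \<times> C. b < a} = {}"
    using assms by auto
  ultimately show ?thesis
    using fin[OF assms(2)] fin[OF assms(3)]
    by (simp add: shuffle_sign_def card_Un_disjoint power_add)
qed

definition wedge_coeff :: "(nat set \<Rightarrow> real) \<Rightarrow> (nat set \<Rightarrow> real) \<Rightarrow> nat set \<Rightarrow> real" where
  "wedge_coeff f h S = (\<Sum>A\<in>Pow S. shuffle_sign A (S - A) * f A * h (S - A))"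

lemma wedge_coeff_assoc:
  assumes S: "finite S"
  shows "wedge_coeff (wedge_coeff f g) h S = wedge_coeff f (wedge_coeff g h) S"
proof -
  have "wedge_coeff (wedge_coeff f g) h S =
    (\<Sum>(A, B)\<in>Sigma (Pow S) Pow.
      shuffle_sign A (S - A) * (shuffle_sign B (A - B) * f B * g (A - B)) * h (S - A))"
    by (subst sum.Sigma[symmetric])
      (auto simp: wedge_coeff_def sum_distrib_left sum_distrib_right S dest: finite_subset[OF _ S])
  also have "\<dots> = (\<Sum>(B, C)\<in>Sigma (Pow S) (\<lambda>B. Pow (S - B)).
      shuffle_sign B (S - B) * f B * (shuffle_sign C (S - B - C) * g C * h (S - B - C)))"
  proof (rule sum.reindex_bij_witness[where i = "\<lambda>(B, C). (B \<union> C, B)" and j = "\<lambda>(A, B). (B, A - B)"],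
      goal_cases)
    case (5 x)
    obtain A B where x: "x = (A, B)" and sub: "B \<subseteq> A" "A \<subseteq> S"
      using 5 by auto
    define C D where "C = A - B" and "D = S - A"
    have fin: "finite B" "finite C" "finite D"
      using sub S by (auto simp: C_def D_def intro: finite_subset)
    have A: "A = B \<union> C" and SB: "S - B = C \<union> D" and D: "S - B - C = D"
      and dis: "B \<inter> C = {}" "C \<inter> D = {}"
      using sub by (auto simp: C_def D_def)
    have "shuffle_sign A D * shuffle_sign B C = shuffle_sign B (S - B) * shuffle_sign C D"
      unfolding A SB using fin dis
      by (simp add: shuffle_sign_Un_left shuffle_sign_Un_right)
    then show ?case
      by (simp add: x D flip: C_def D_def)
  qed auto
  also have "\<dots> = wedge_coeff f (wedge_coeff g h) S"
    by (subst sum.Sigma[symmetric])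
      (auto simp: wedge_coeff_def sum_distrib_left sum_distrib_right S)
  finally show ?thesis .
qed

lemma wedge_coeff_outside:
  assumes f: "\<forall>S. \<not> S \<subseteq> X \<longrightarrow> f S = 0" and h: "\<forall>S. \<not> S \<subseteq> X \<longrightarrow> h S = 0"
    and S: "\<not> S \<subseteq> X"
  shows "wedge_coeff f h S = 0"
  unfolding wedge_coeff_def
proof (rule sum.neutral, rule ballI)
  fix A
  from S consider "\<not> A \<subseteq> X" | "\<not> S - A \<subseteq> X"
    by blast
  then show "shuffle_sign A (S - A) * f A * h (S - A) = 0"
    by cases (simp_all add: f[rule_format] h[rule_format])
qed

text \<open>The multiplication \<open>*\<close> of the type \<open>ext\<close> is the exterior product.\<close>

instantiation ext :: (euclidean_space) real_algebra_1
begin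

lift_definition one_ext :: "'a ext" is "\<lambda>S. if S = {} then 1 else 0" by auto

lift_definition times_ext :: "'a ext \<Rightarrow> 'a ext \<Rightarrow> 'a ext" is wedge_coeff
  by (blast intro: wedge_coeff_outside)

instance
proof
  fix a b c :: "'a ext" and r :: real
  show "a * b * c = a * (b * c)"
    by (rule ext_eqI) (simp add: times_ext.rep_eq wedge_coeff_assoc finite_subset)
  show "1 * a = a"
  proof (rule ext_eqI)
    fix S :: "nat set" assume "S \<subseteq> {..<DIM('a)}"
    then have "finite S" by (rule finite_subset) simp
    then have "(\<Sum>A\<in>Pow S. if A = {} then ext_coeff a S else 0) = ext_coeff a S"
      by (subst sum.delta) auto
    moreover have "ext_coeff (1 * a) S = (\<Sum>A\<in>Pow S. if A = {} then ext_coeff a S else 0)"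
      by (auto simp: times_ext.rep_eq one_ext.rep_eq wedge_coeff_def intro!: sum.cong)
    ultimately show "ext_coeff (1 * a) S = ext_coeff a S" by simp
  qed
  show "a * 1 = a"
  proof (rule ext_eqI)
    fix S :: "nat set" assume "S \<subseteq> {..<DIM('a)}"
    then have "finite S" by (rule finite_subset) simp
    then have "(\<Sum>A\<in>Pow S. if A = S then ext_coeff a S else 0) = ext_coeff a S"
      by (subst sum.delta) auto
    moreover have "ext_coeff (a * 1) S = (\<Sum>A\<in>Pow S. if A = S then ext_coeff a S else 0)"
      by (auto simp: times_ext.rep_eq one_ext.rep_eq wedge_coeff_def intro!: sum.cong)
    ultimately show "ext_coeff (a * 1) S = ext_coeff a S" by simp
  qed
  show "(a + b) * c = a * c + b * c"
    by (rule ext_eqI) (simp add: times_ext.rep_eq plus_ext.rep_eq wedge_coeff_def algebra_simps sum.distrib)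
  show "a * (b + c) = a * b + a * c"
    by (rule ext_eqI) (simp add: times_ext.rep_eq plus_ext.rep_eq wedge_coeff_def algebra_simps sum.distrib)
  show "r *\<^sub>R a * b = r *\<^sub>R (a * b)"
    by (rule ext_eqI)
      (simp add: times_ext.rep_eq scaleR_ext.rep_eq wedge_coeff_def sum_distrib_left mult_ac)
  show "a * r *\<^sub>R b = r *\<^sub>R (a * b)"
    by (rule ext_eqI)
      (simp add: times_ext.rep_eq scaleR_ext.rep_eq wedge_coeff_def sum_distrib_left mult_ac)
  show "(0 :: 'a ext) \<noteq> 1"
    by transfer (auto simp: fun_eq_iff)
qed

end

instantiation ext :: (euclidean_space) real_inner
begin

definition inner_ext :: "'a ext \<Rightarrow> 'a ext \<Rightarrow> real" where
  "inner_ext \<phi> \<psi> = (\<Sum>S\<in>Pow {..<DIM('a)}. ext_coeff \<phi> S * ext_coeff \<psi> S)"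

definition norm_ext :: "'a ext \<Rightarrow> real" where
  "norm_ext \<phi> = sqrt (\<phi> \<bullet> \<phi>)"

definition sgn_ext :: "'a ext \<Rightarrow> 'a ext" where
  "sgn_ext \<phi> = \<phi> /\<^sub>R norm \<phi>"

definition dist_ext :: "'a ext \<Rightarrow> 'a ext \<Rightarrow> real" where
  "dist_ext \<phi> \<psi> = norm (\<phi> - \<psi>)"

definition uniformity_ext :: "('a ext \<times> 'a ext) filter" where
  "uniformity_ext = (INF e\<in>{0<..}. principal {(\<phi>, \<psi>). dist \<phi> \<psi> < e})"

definition open_ext :: "'a ext set \<Rightarrow> bool" where
  "open_ext U \<longleftrightarrow> (\<forall>\<phi>\<in>U. \<forall>\<^sub>F (\<phi>', \<psi>) in uniformity. \<phi>' = \<phi> \<longrightarrow> \<psi> \<in> U)"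

instance
proof
  fix x y z :: "'a ext" and r :: real
  show "x \<bullet> y = y \<bullet> x"
    by (simp add: inner_ext_def mult.commute)
  show "(x + y) \<bullet> z = x \<bullet> z + y \<bullet> z"
    by (simp add: inner_ext_def plus_ext.rep_eq algebra_simps sum.distrib)
  show "(r *\<^sub>R x) \<bullet> y = r * (x \<bullet> y)"
    by (simp add: inner_ext_def scaleR_ext.rep_eq sum_distrib_left mult_ac)
  show "0 \<le> x \<bullet> x"
    by (simp add: inner_ext_def sum_nonneg)
  show "x \<bullet> x = 0 \<longleftrightarrow> x = 0"
  proof
    assume "x \<bullet> x = 0"
    then have "\<forall>S\<in>Pow {..<DIM('a)}. ext_coeff x S * ext_coeff x S = 0"
      unfolding inner_ext_def by (subst (asm) sum_nonneg_eq_0_iff) auto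
    then have "ext_coeff x S = ext_coeff 0 S" for S
      by (cases "S \<subseteq> {..<DIM('a)}") (auto simp: zero_ext.rep_eq ext_coeff_outside)
    then show "x = 0"
      by (rule ext_eqI)
  qed (simp add: inner_ext_def zero_ext.rep_eq)
qed (rule norm_ext_def sgn_ext_def dist_ext_def uniformity_ext_def open_ext_def)+

end

lift_definition ext_vec :: "'a::euclidean_space \<Rightarrow> 'a ext" is
  "\<lambda>v S. \<Sum>i<DIM('a). if S = {i} then v \<bullet> ref_basis i else 0"
  by (auto intro!: sum.neutral)

lift_definition ext_grade :: "nat \<Rightarrow> 'a::euclidean_space ext \<Rightarrow> 'a ext" is
  "\<lambda>p f S. if card S = p then f S else 0"
  by simp

abbreviation wedge :: "'a::euclidean_space list \<Rightarrow> 'a ext" where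
  "wedge vs \<equiv> prod_list (map ext_vec vs)"

text \<open>The type \<open>ext\<close> is the exterior algebra with its usual grading and inner product: vectors
  square to zero, and the increasing products of the reference basis are the coordinate vectors,
  hence an orthonormal basis adapted to the grading.\<close>

lemma linear_ext_vec: "linear ext_vec"
proof
  fix v w :: "'a::euclidean_space" and r :: real
  have "ext_coeff (ext_vec (v + w)) S = ext_coeff (ext_vec v + ext_vec w) S" for S
    unfolding ext_vec.rep_eq plus_ext.rep_eq sum.distrib[symmetric]
    by (rule sum.cong) (simp_all add: inner_add_left)
  then show "ext_vec (v + w) = ext_vec v + ext_vec w"
    by (rule ext_eqI)
  have "ext_coeff (ext_vec (r *\<^sub>R v)) S = ext_coeff (r *\<^sub>R ext_vec v) S" for S
    unfolding ext_vec.rep_eq scaleR_ext.rep_eq sum_distrib_left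
    by (rule sum.cong) simp_all
  then show "ext_vec (r *\<^sub>R v) = r *\<^sub>R ext_vec v"
    by (rule ext_eqI)
qed

lemma ext_coeff_vec_singleton:
  "i < DIM('a) \<Longrightarrow> ext_coeff (ext_vec (v :: 'a::euclidean_space)) {i} = v \<bullet> ref_basis i"
  by (simp add: ext_vec.rep_eq)

lemma ext_coeff_vec_other:
  "\<forall>i. S \<noteq> {i} \<Longrightarrow> ext_coeff (ext_vec (v :: 'a::euclidean_space)) S = 0"
  by (simp add: ext_vec.rep_eq)

lemma ext_coeff_vec_nonzeroE:
  assumes "ext_coeff (ext_vec (v :: 'a::euclidean_space)) S \<noteq> 0"
  obtains i where "S = {i}"
  using assms ext_coeff_vec_other[of S v] by blast

lemma ext_vec_square: "ext_vec v * ext_vec v = (0 :: 'a::euclidean_space ext)"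
proof -
  define f where "f = ext_coeff (ext_vec v)"
  have "wedge_coeff f f S = 0" for S
  proof (cases "\<exists>i j. i < j \<and> S = {i, j}")
    case True
    then obtain i j where ij: "i < j" "S = {i, j}" by blast
    have "wedge_coeff f f S =
      (\<Sum>A\<in>{{i}, {j}}. shuffle_sign A (S - A) * f A * f (S - A))"
      unfolding wedge_coeff_def
    proof (rule sum.mono_neutral_right)
      show "\<forall>A\<in>Pow S - {{i}, {j}}. shuffle_sign A (S - A) * f A * f (S - A) = 0"
      proof
        fix A assume "A \<in> Pow S - {{i}, {j}}"
        then have "A = {} \<or> A = {i, j}"
          using ij by blast
        then have "f A = 0"
          unfolding f_def using ij by (intro ext_coeff_vec_other) auto
        then show "shuffle_sign A (S - A) * f A * f (S - A) = 0" by simp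
      qed
    qed (use ij in auto)
    moreover have "{i, j} - {i} = {j}" "{i, j} - {j} = {i}" "{i} \<noteq> {j}"
      using ij by auto
    moreover have "shuffle_sign {i} {j} = 1"
    proof -
      have "{(a, b) \<in> {i} \<times> {j}. b < a} = {}" using ij by auto
      then show ?thesis by (simp only: shuffle_sign_def) simp
    qed
    moreover have "shuffle_sign {j} {i} = - 1"
    proof -
      have "{(a, b) \<in> {j} \<times> {i}. b < a} = {(j, i)}" using ij by auto
      then show ?thesis by (simp only: shuffle_sign_def) simp
    qed
    ultimately show ?thesis using ij(2) by simp
  next
    case False
    have "f A * f (S - A) = 0" if "A \<subseteq> S" for A
    proof (rule ccontr)
      assume "f A * f (S - A) \<noteq> 0"
      then have "f A \<noteq> 0" "f (S - A) \<noteq> 0" by auto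
      then obtain i j where "A = {i}" "S - A = {j}"
        unfolding f_def by (elim ext_coeff_vec_nonzeroE)
      with that have "S = {i, j}" "i \<noteq> j" by auto
      moreover have "{i, j} = {j, i}" by blast
      ultimately show False using False by (metis linorder_neq_iff)
    qed
    then show ?thesis by (auto simp: wedge_coeff_def mult.assoc intro!: sum.neutral)
  qed
  then show ?thesis
    by (intro ext_eqI) (simp add: times_ext.rep_eq zero_ext.rep_eq f_def)
qed

lemma ref_basis: "bij_betw (ref_basis :: nat \<Rightarrow> 'a::euclidean_space) {..<DIM('a)} Basis"
  unfolding ref_basis_def
  by (rule someI_ex[of "\<lambda>b. bij_betw b {..<DIM('a)} Basis"])
    (use ex_bij_betw_nat_finite[of "Basis :: 'a set"] in \<open>simp add: atLeast0LessThan\<close>)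

lemma inner_ref_basis:
  assumes "i < DIM('a)" "j < DIM('a)"
  shows "(ref_basis i :: 'a::euclidean_space) \<bullet> ref_basis j = (if i = j then 1 else 0)"
proof -
  note bij = ref_basis[where 'a = 'a]
  have "(ref_basis i :: 'a) \<in> Basis" "(ref_basis j :: 'a) \<in> Basis"
    using assms bij_betwE[OF bij] by auto
  moreover have "(ref_basis i :: 'a) = ref_basis j \<longleftrightarrow> i = j"
    using assms inj_on_eq_iff[OF bij_betw_imp_inj_on[OF bij]] by simp
  ultimately show ?thesis by (auto simp: inner_Basis)
qed

lemma ext_coeff_wedge_ref_basis:
  assumes "sorted_wrt (<) is" "set is \<subseteq> {..<DIM('a)}"
  shows "ext_coeff (wedge (map (ref_basis :: nat \<Rightarrow> 'a::euclidean_space) is)) S =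
    (if S = set is then 1 else 0)"
  using assms
proof (induction "is" arbitrary: S)
  case Nil
  then show ?case by (simp add: one_ext.rep_eq)
next
  case (Cons i "is")
  let ?f = "ext_coeff (ext_vec (ref_basis i :: 'a))"
  have f: "?f A = (if A = {i} then 1 else 0)" for A
  proof (cases "\<exists>k. A = {k}")
    case True
    then obtain k where k: "A = {k}" by blast
    show ?thesis
    proof (cases "k < DIM('a)")
      case True
      then show ?thesis using k Cons.prems
        by (simp add: ext_coeff_vec_singleton inner_ref_basis)
    next
      case False
      then show ?thesis using k Cons.prems by (auto simp: ext_coeff_outside)
    qed
  next
    case False
    then show ?thesis by (auto simp: ext_coeff_vec_other)
  qed
  have i: "i \<notin> set is" "\<And>k. k \<in> set is \<Longrightarrow> i < k"
    using Cons.prems by auto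
  have summand: "shuffle_sign A (S - A) * ?f A * ext_coeff (wedge (map (ref_basis :: nat \<Rightarrow> 'a) is)) (S - A)
    = (if A = {i} then if S = insert i (set is) then 1 else 0 else 0)" if "A \<subseteq> S" for A
  proof (cases "A = {i} \<and> S - {i} = set is")
    case True
    then have "shuffle_sign A (S - A) = shuffle_sign {i} (set is)"
      by simp
    also have "{(a, b) \<in> {i} \<times> set is. b < a} = {}"
      using i by fastforce
    then have "shuffle_sign {i} (set is) = 1"
      by (simp only: shuffle_sign_def) simp
    finally have "shuffle_sign A (S - A) = 1" .
    with True that show ?thesis
      using Cons by (auto simp: f)
  next
    case False
    then show ?thesis using Cons that i by (auto simp: f)
  qed
  have "ext_coeff (wedge (map (ref_basis :: nat \<Rightarrow> 'a) (i # is))) S =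
    (\<Sum>A\<in>Pow S. if A = {i} then if S = insert i (set is) then 1 else 0 else 0)"
    unfolding list.map prod_list.Cons times_ext.rep_eq wedge_coeff_def
    by (rule sum.cong) (use summand in auto)
  also have "\<dots> = (if S = set (i # is) then 1 else 0)"
  proof (cases "finite S")
    case True
    then show ?thesis by (subst sum.delta) auto
  next
    case False
    then have "infinite (Pow S)" "S \<noteq> set (i # is)" by (auto simp: finite_Pow_iff simp del: Pow_def)
    then show ?thesis by (simp only: sum.infinite simp_thms if_False)
  qed
  finally show ?case .
qed


section \<open>Clifford product\<close>

definition interior :: "'a::euclidean_space \<Rightarrow> 'a ext \<Rightarrow> 'a ext" where
  "interior v = adjoint (\<lambda>\<psi>. ext_vec v * \<psi>)"

text \<open>The defining property determines the product because \<open>V\<close> generates \<open>\<Lambda>V\<close>; existence follows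
  from \<open>e.e = - g(e, e)\<close> for the operators \<open>\<psi> \<mapsto> e \<and> \<psi> - i\<^sub>e \<psi>\<close>.\<close>

definition clifford :: "'a::euclidean_space ext \<Rightarrow> 'a ext \<Rightarrow> 'a ext" where
  "clifford = (THE m. bilinear m \<and>
      (\<forall>\<phi> \<psi> \<xi>. m (m \<phi> \<psi>) \<xi> = m \<phi> (m \<psi> \<xi>)) \<and>
      (\<forall>\<psi>. m 1 \<psi> = \<psi> \<and> m \<psi> 1 = \<psi>) \<and>
      (\<forall>v \<psi>. m (ext_vec v) \<psi> = ext_vec v * \<psi> - interior v \<psi>))"

definition clifford_ad :: "'a::euclidean_space ext \<Rightarrow> 'a ext \<Rightarrow> 'a ext" where
  "clifford_ad \<phi> \<psi> = clifford \<phi> \<psi> - clifford \<psi> \<phi>"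


section \<open>Double forms\<close>

text \<open>A bilinear form on \<open>\<Lambda>\<^sup>pV \<times> \<Lambda>\<^sup>qV\<close> is identified with its extension to \<open>\<Lambda>V \<times> \<Lambda>V\<close> by zero on
  the components of other degrees. Equality of \<open>(p, q)\<close>-double forms is then equality of functions.\<close>

type_synonym 'a dform = "'a ext \<Rightarrow> 'a ext \<Rightarrow> real"

definition double_form :: "nat \<Rightarrow> nat \<Rightarrow> 'a::euclidean_space dform \<Rightarrow> bool" where
  "double_form p q \<omega> \<longleftrightarrow>
    bilinear \<omega> \<and> (\<forall>\<phi> \<psi>. \<omega> \<phi> \<psi> = \<omega> (ext_grade p \<phi>) (ext_grade q \<psi>))"

definition symmetric_dform :: "'a::euclidean_space dform \<Rightarrow> bool" where
  "symmetric_dform \<omega> \<longleftrightarrow> (\<forall>\<phi> \<psi>. \<omega> \<phi> \<psi> = \<omega> \<psi> \<phi>)"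

text \<open>The vectors are indexed from \<open>0\<close>, whence the exponent \<open>Suc j\<close>. Only \<open>q \<ge> 1\<close> is meaningful.\<close>

definition first_bianchi :: "nat \<Rightarrow> nat \<Rightarrow> 'a::euclidean_space dform \<Rightarrow> bool" where
  "first_bianchi p q \<omega> \<longleftrightarrow> (\<forall>x y :: nat \<Rightarrow> 'a.
    (\<Sum>j<p + 1. (- 1) ^ Suc j *
      \<omega> (wedge (map x ([0..<j] @ [Suc j..<p + 1]))) (wedge (x j # map y [0..<q - 1]))) = 0)"

text \<open>The product of a \<open>(p, q)\<close>-double form and an \<open>(r, s)\<close>-double form: the unique
  \<open>(p + r, q + s)\<close>-double form with the prescribed values on decomposable elements, which span
  \<open>\<Lambda>\<^bsup>p + r\<^esup>V\<close> and \<open>\<Lambda>\<^bsup>q + s\<^esup>V\<close>. It exists since these values are multilinear and alternating in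
  \<open>x\<close> and in \<open>y\<close>.\<close>

definition dform_prod ::
    "nat \<Rightarrow> nat \<Rightarrow> nat \<Rightarrow> nat \<Rightarrow> 'a::euclidean_space dform \<Rightarrow> 'a dform \<Rightarrow> 'a dform" where
  "dform_prod p q r s \<omega>\<^sub>1 \<omega>\<^sub>2 = (THE \<eta>. double_form (p + r) (q + s) \<eta> \<and>
    (\<forall>x y :: nat \<Rightarrow> 'a. \<eta> (wedge (map x [0..<p + r])) (wedge (map y [0..<q + s])) =
      1 / (fact p * fact r * fact s * fact q) *
      (\<Sum>\<sigma> | \<sigma> permutes {..<p + r}. \<Sum>\<rho> | \<rho> permutes {..<q + s}.
        of_int (sign \<sigma>) * of_int (sign \<rho>) *
        \<omega>\<^sub>1 (wedge (map (x \<circ> \<sigma>) [0..<p])) (wedge (map (y \<circ> \<rho>) [0..<q])) *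
        \<omega>\<^sub>2 (wedge (map (x \<circ> \<sigma>) [p..<p + r])) (wedge (map (y \<circ> \<rho>) [q..<q + s])))))"

definition dform_one :: "'a::euclidean_space dform" where
  "dform_one \<phi> \<psi> = ext_grade 0 \<phi> \<bullet> ext_grade 0 \<psi>"

text \<open>On \<open>\<Lambda>\<^sup>1V = V\<close> the inner product of \<open>\<Lambda>V\<close> is \<open>g\<close>.\<close>

definition dform_metric :: "'a::euclidean_space dform" where
  "dform_metric \<phi> \<psi> = ext_grade 1 \<phi> \<bullet> ext_grade 1 \<psi>"

primrec dform_metric_pow :: "nat \<Rightarrow> 'a::euclidean_space dform" where
  "dform_metric_pow 0 = dform_one"
| "dform_metric_pow (Suc k) = dform_prod 1 1 k k dform_metric (dform_metric_pow k)"

text \<open>\<open>DIM('a)\<close> orthonormal vectors automatically form a basis.\<close>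

definition orthonormal_basis :: "(nat \<Rightarrow> 'a::euclidean_space) \<Rightarrow> bool" where
  "orthonormal_basis e \<longleftrightarrow>
    (\<forall>i<DIM('a). \<forall>j<DIM('a). e i \<bullet> e j = (if i = j then 1 else 0))"

definition contraction :: "(nat \<Rightarrow> 'a::euclidean_space) \<Rightarrow> 'a dform \<Rightarrow> 'a dform" where
  "contraction e \<omega> \<phi> \<psi> = (\<Sum>j<DIM('a). \<omega> (ext_vec (e j) * \<phi>) (ext_vec (e j) * \<psi>))"

definition weitzenboeck ::
    "(nat \<Rightarrow> 'a::euclidean_space) \<Rightarrow> nat \<Rightarrow> 'a dform \<Rightarrow> 'a dform" where
  "weitzenboeck e p \<omega> \<psi>\<^sub>1 \<psi>\<^sub>2 = 1 / 4 *
    (\<Sum>j<DIM('a). \<Sum>i<j. \<Sum>l<DIM('a). \<Sum>k<l.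
      \<omega> (wedge [e i, e j]) (wedge [e k, e l]) *
      (clifford_ad (clifford (ext_vec (e i)) (ext_vec (e j))) (ext_grade p \<psi>\<^sub>1) \<bullet>
       clifford_ad (clifford (ext_vec (e k)) (ext_vec (e l))) (ext_grade p \<psi>\<^sub>2)))"

end

theory Submission
  imports Defs
begin

text \<open>Write \<open>\<epsilon>\<^sub>v\<close> for exterior multiplication by \<open>v\<close> and \<open>\<iota>\<^sub>v\<close> for its adjoint, the interior product.
  Both sides of the identity can be written in terms of these operators, and the proof brings each
  of them to the same normal form
  \<open>\<Sum>\<^sub>i\<^sub>k c\<omega>(e\<^sub>i, e\<^sub>k) \<langle>\<iota>\<^sub>i\<psi>\<^sub>1, \<iota>\<^sub>k\<psi>\<^sub>2\<rangle> - 1/2 \<Sum>\<^sub>i\<^sub>j\<^sub>k\<^sub>l \<omega>\<^sub>i\<^sub>j\<^sub>k\<^sub>l \<langle>\<iota>\<^sub>j\<iota>\<^sub>i\<psi>\<^sub>1, \<iota>\<^sub>l\<iota>\<^sub>k\<psi>\<^sub>2\<rangle>\<close>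
  for \<open>\<psi>\<^sub>1\<close>, \<open>\<psi>\<^sub>2\<close> of degree \<open>p\<close>.

  The left-hand side. The operator \<open>ad\<close> of \<open>u.v\<close> is a derivation of the Clifford product, and it agrees
  with \<open>2 (\<epsilon>\<^sub>v \<iota>\<^sub>u - \<epsilon>\<^sub>u \<iota>\<^sub>v)\<close> (\<open>clifford_ad_vec_vec\<close>). Since \<open>\<omega>\<^sub>i\<^sub>j\<^sub>k\<^sub>l\<close> is antisymmetric in each pair, the
  Weitzenboeck transformation becomes \<open>\<Sum> \<omega>\<^sub>i\<^sub>j\<^sub>k\<^sub>l \<langle>\<epsilon>\<^sub>j\<iota>\<^sub>i\<psi>\<^sub>1, \<epsilon>\<^sub>l\<iota>\<^sub>k\<psi>\<^sub>2\<rangle>\<close> (\<open>weitzenboeck_eq_sum\<close>). Moving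
  \<open>\<epsilon>\<^sub>j\<close> across the inner product produces a contraction term and
  \<open>- \<Sum> \<omega>\<^sub>i\<^sub>j\<^sub>k\<^sub>l \<langle>\<iota>\<^sub>l\<iota>\<^sub>i\<psi>\<^sub>1, \<iota>\<^sub>j\<iota>\<^sub>k\<psi>\<^sub>2\<rangle>\<close>, and the first Bianchi identity turns the latter into the
  second sum of the normal form (\<open>sum_bianchi\<close>).

  The right-hand side. For an orthonormal basis, the product of double forms is
  \<open>1/(p! q!) \<Sum> \<omega>\<^sub>1(e\<^sub>I, e\<^sub>K) \<omega>\<^sub>2(\<iota>\<^sub>I \<phi>, \<iota>\<^sub>K \<psi>)\<close>, the sum running over all index tuples \<open>I\<close>, \<open>K\<close> of lengths
  \<open>p\<close>, \<open>q\<close> (\<open>dform_prod_eq_coord\<close>). Together with \<open>\<Sum>\<^sub>i \<epsilon>\<^sub>i\<iota>\<^sub>i = k\<close> in degree \<open>k\<close>, this identifies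
  \<open>g\<^sup>k / k!\<close> with the inner product of \<open>\<Lambda>\<^sup>kV\<close> (\<open>dform_metric_pow_eq\<close>) and evaluates the term in
  \<open>g c\<omega>\<close>.\<close>

section \<open>Coordinates on the exterior algebra\<close>

lemma ext_coeff_sum: "ext_coeff (sum f A) S = (\<Sum>x\<in>A. ext_coeff (f x) S)"
  by (induction A rule: infinite_finite_induct) (simp_all add: zero_ext.rep_eq plus_ext.rep_eq)

text \<open>The coordinate vector \<open>b\<^sub>i\<^sub>1 \<and> \<dots> \<and> b\<^sub>i\<^sub>p\<close> of the set \<open>S = {i\<^sub>1 < \<dots> < i\<^sub>p}\<close>.\<close>

definition basis_ext :: "nat set \<Rightarrow> 'a::euclidean_space ext" where
  "basis_ext S = wedge (map ref_basis (sorted_list_of_set S))"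

lemma ext_coeff_basis_ext:
  assumes "S \<subseteq> {..<DIM('a)}"
  shows "ext_coeff (basis_ext S :: 'a::euclidean_space ext) T = (if T = S then 1 else 0)"
proof -
  have "finite S" using assms by (rule finite_subset) simp
  then show ?thesis
    unfolding basis_ext_def using assms by (subst ext_coeff_wedge_ref_basis) simp_all
qed

lemma ext_eq_sum_basis_ext:
  "\<phi> = (\<Sum>S\<in>Pow {..<DIM('a)}. ext_coeff \<phi> S *\<^sub>R basis_ext S)" for \<phi> :: "'a::euclidean_space ext"
proof (rule ext_eqI)
  fix T assume T: "T \<subseteq> {..<DIM('a)}"
  have "ext_coeff (\<Sum>S\<in>Pow {..<DIM('a)}. ext_coeff \<phi> S *\<^sub>R (basis_ext S :: 'a ext)) T
      = (\<Sum>S\<in>Pow {..<DIM('a)}. if T = S then ext_coeff \<phi> S else 0)"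
    unfolding ext_coeff_sum
    by (rule sum.cong) (simp_all add: scaleR_ext.rep_eq ext_coeff_basis_ext)
  also have "\<dots> = ext_coeff \<phi> T"
    by (subst sum.delta') (use T in auto)
  finally show "ext_coeff \<phi> T = ext_coeff (\<Sum>S\<in>Pow {..<DIM('a)}. ext_coeff \<phi> S *\<^sub>R (basis_ext S :: 'a ext)) T"
    by simp
qed

lemma inner_eq_sum_ref_basis:
  "v \<bullet> w = (\<Sum>i<DIM('a). (v \<bullet> ref_basis i) * (w \<bullet> ref_basis i))" for v w :: "'a::euclidean_space"
proof -
  have "v \<bullet> w = (\<Sum>b\<in>Basis. (v \<bullet> b) * (w \<bullet> b))"
    by (rule euclidean_inner)
  also have "\<dots> = (\<Sum>i<DIM('a). (v \<bullet> ref_basis i) * (w \<bullet> ref_basis i))"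
    by (rule sum.reindex_bij_betw[OF ref_basis, symmetric])
  finally show ?thesis .
qed

lemma ext_coeff_vec_mult:
  fixes \<phi> :: "'a::euclidean_space ext"
  assumes U: "U \<subseteq> {..<DIM('a)}"
  shows "ext_coeff (ext_vec v * \<phi>) U =
    (\<Sum>i\<in>U. shuffle_sign {i} (U - {i}) * (v \<bullet> ref_basis i) * ext_coeff \<phi> (U - {i}))"
proof -
  have fin: "finite U" using U by (rule finite_subset) simp
  have "ext_coeff (ext_vec v * \<phi>) U =
      (\<Sum>A\<in>(\<lambda>i. {i}) ` U. shuffle_sign A (U - A) * ext_coeff (ext_vec v) A * ext_coeff \<phi> (U - A))"
    unfolding times_ext.rep_eq wedge_coeff_def
  proof (rule sum.mono_neutral_right)
    show "\<forall>A\<in>Pow U - (\<lambda>i. {i}) ` U.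
        shuffle_sign A (U - A) * ext_coeff (ext_vec v) A * ext_coeff \<phi> (U - A) = 0"
    proof
      fix A assume A: "A \<in> Pow U - (\<lambda>i. {i}) ` U"
      then have "ext_coeff (ext_vec v) A = 0"
        by (intro ext_coeff_vec_other) blast
      then show "shuffle_sign A (U - A) * ext_coeff (ext_vec v) A * ext_coeff \<phi> (U - A) = 0"
        by simp
    qed
  qed (use fin in auto)
  also have "\<dots> = (\<Sum>i\<in>U. shuffle_sign {i} (U - {i}) * ext_coeff (ext_vec v) {i} * ext_coeff \<phi> (U - {i}))"
    by (subst sum.reindex) (auto simp: inj_on_def)
  also have "\<dots> = (\<Sum>i\<in>U. shuffle_sign {i} (U - {i}) * (v \<bullet> ref_basis i) * ext_coeff \<phi> (U - {i}))"
    by (rule sum.cong) (use U in \<open>auto simp: ext_coeff_vec_singleton\<close>)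
  finally show ?thesis .
qed

section \<open>Interior multiplication\<close>

text \<open>The interior product in coordinates. Writing it down proves that exterior multiplication has an
  adjoint, which the choice operator behind \<^const>\<open>adjoint\<close> does not give by itself.\<close>

lift_definition interior_coord :: "'a::euclidean_space \<Rightarrow> 'a ext \<Rightarrow> 'a ext" is
  "\<lambda>v f U. if U \<subseteq> {..<DIM('a)} then
    (\<Sum>i\<in>{..<DIM('a)} - U. shuffle_sign {i} U * (v \<bullet> ref_basis i) * f (insert i U)) else 0"
  by simp

lemma interior_coord_adjoint: "(ext_vec v * \<phi>) \<bullet> \<psi> = \<phi> \<bullet> interior_coord v \<psi>"
  for \<phi> \<psi> :: "'a::euclidean_space ext"
proof -
  let ?N = "{..<DIM('a)}"
  have "(ext_vec v * \<phi>) \<bullet> \<psi> = (\<Sum>U\<in>Pow ?N. \<Sum>i\<in>U.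
      shuffle_sign {i} (U - {i}) * (v \<bullet> ref_basis i) * ext_coeff \<phi> (U - {i}) * ext_coeff \<psi> U)"
    unfolding inner_ext_def by (rule sum.cong) (auto simp: ext_coeff_vec_mult sum_distrib_right)
  also have "\<dots> = (\<Sum>(U, i)\<in>Sigma (Pow ?N) (\<lambda>U. U).
      shuffle_sign {i} (U - {i}) * (v \<bullet> ref_basis i) * ext_coeff \<phi> (U - {i}) * ext_coeff \<psi> U)"
    by (rule sum.Sigma) (auto intro: finite_subset)
  also have "\<dots> = (\<Sum>(U, i)\<in>Sigma (Pow ?N) (\<lambda>U. ?N - U).
      ext_coeff \<phi> U * (shuffle_sign {i} U * (v \<bullet> ref_basis i) * ext_coeff \<psi> (insert i U)))"
    by (rule sum.reindex_bij_witness[where i = "\<lambda>(U, i). (insert i U, i)"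
          and j = "\<lambda>(U, i). (U - {i}, i)"])
      (auto simp: insert_absorb)
  also have "\<dots> = (\<Sum>U\<in>Pow ?N. \<Sum>i\<in>?N - U.
      ext_coeff \<phi> U * (shuffle_sign {i} U * (v \<bullet> ref_basis i) * ext_coeff \<psi> (insert i U)))"
    by (rule sum.Sigma[symmetric]) auto
  also have "\<dots> = \<phi> \<bullet> interior_coord v \<psi>"
    unfolding inner_ext_def
    by (rule sum.cong) (auto simp: interior_coord.rep_eq sum_distrib_left)
  finally show ?thesis .
qed

lemma interior_adjoint: "(ext_vec v * \<phi>) \<bullet> \<psi> = \<phi> \<bullet> interior v \<psi>"
  for \<phi> \<psi> :: "'a::euclidean_space ext"
  unfolding interior_def adjoint_def
  by (rule someI2[of _ "interior_coord v"]) (auto simp: interior_coord_adjoint)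

lemma interior_adjoint': "\<psi> \<bullet> (ext_vec v * \<phi>) = interior v \<psi> \<bullet> \<phi>"
  using interior_adjoint[of v \<phi> \<psi>] by (simp add: inner_commute)

lemma interior_eq_coord: "interior v = (interior_coord v :: 'a::euclidean_space ext \<Rightarrow> 'a ext)"
proof
  fix \<psi> :: "'a ext"
  have "\<forall>\<phi>. \<phi> \<bullet> interior v \<psi> = \<phi> \<bullet> interior_coord v \<psi>"
    by (metis interior_adjoint interior_coord_adjoint)
  then show "interior v \<psi> = interior_coord v \<psi>"
    by (metis vector_eq_ldot)
qed

lemma ext_coeff_interior:
  fixes \<phi> :: "'a::euclidean_space ext"
  assumes "U \<subseteq> {..<DIM('a)}"
  shows "ext_coeff (interior v \<phi>) U =
    (\<Sum>i\<in>{..<DIM('a)} - U. shuffle_sign {i} U * (v \<bullet> ref_basis i) * ext_coeff \<phi> (insert i U))"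
  using assms by (simp add: interior_eq_coord interior_coord.rep_eq)

lemma linear_interior: "linear (interior v)"
proof
  fix \<phi> \<psi> :: "'a ext" and r :: real
  have "\<xi> \<bullet> interior v (\<phi> + \<psi>) = \<xi> \<bullet> (interior v \<phi> + interior v \<psi>)" for \<xi>
    by (simp add: inner_add_right flip: interior_adjoint)
  then show "interior v (\<phi> + \<psi>) = interior v \<phi> + interior v \<psi>"
    by (metis vector_eq_ldot)
  have "\<xi> \<bullet> interior v (r *\<^sub>R \<phi>) = \<xi> \<bullet> (r *\<^sub>R interior v \<phi>)" for \<xi>
    by (simp flip: interior_adjoint)
  then show "interior v (r *\<^sub>R \<phi>) = r *\<^sub>R interior v \<phi>"
    by (metis vector_eq_ldot)
qed

lemma shuffle_sign_square: "shuffle_sign A B * shuffle_sign A B = 1"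
  by (simp add: shuffle_sign_def flip: power_mult_distrib)

lemma shuffle_sign_singletons:
  assumes "i \<noteq> j"
  shows "shuffle_sign {i} {j} * shuffle_sign {j} {i} = - 1"
proof -
  have *: "shuffle_sign {a} {b} = (if b < a then - 1 else 1)" for a b
  proof -
    have "{(x, y) \<in> {a} \<times> {b}. y < x} = (if b < a then {(a, b)} else {})" by auto
    then show ?thesis by (simp add: shuffle_sign_def)
  qed
  show ?thesis using assms by (auto simp: *)
qed

lemma interior_vec_mult:
  fixes \<phi> :: "'a::euclidean_space ext"
  shows "interior v (ext_vec w * \<phi>) = (v \<bullet> w) *\<^sub>R \<phi> - ext_vec w * interior v \<phi>"
proof (rule ext_eqI)
  let ?N = "{..<DIM('a)}"
  fix U assume U: "U \<subseteq> ?N"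
  have fin: "finite U" using U by (rule finite_subset) simp
  define c where "c i j = shuffle_sign {i} U * shuffle_sign {j} (insert i U - {j}) *
    (v \<bullet> ref_basis i) * (w \<bullet> ref_basis j) * ext_coeff \<phi> (insert i U - {j})" for i j
  have cross: "shuffle_sign {j} (U - {j}) * shuffle_sign {i} (U - {j}) =
      - (shuffle_sign {i} U * shuffle_sign {j} (insert i U - {j}))" if "i \<notin> U" "j \<in> U" for i j
  proof -
    have ij: "i \<noteq> j" using that by auto
    have "shuffle_sign {i} (U - {j} \<union> {j}) = shuffle_sign {i} (U - {j}) * shuffle_sign {i} {j}"
      by (rule shuffle_sign_Un_right) (use fin in auto)
    moreover have "U - {j} \<union> {j} = U" using that by auto
    ultimately have 1: "shuffle_sign {i} U = shuffle_sign {i} (U - {j}) * shuffle_sign {i} {j}"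
      by simp
    have "shuffle_sign {j} (U - {j} \<union> {i}) = shuffle_sign {j} (U - {j}) * shuffle_sign {j} {i}"
      by (rule shuffle_sign_Un_right) (use fin that in auto)
    moreover have "U - {j} \<union> {i} = insert i U - {j}" using ij by auto
    ultimately have 2: "shuffle_sign {j} (insert i U - {j}) = shuffle_sign {j} (U - {j}) * shuffle_sign {j} {i}"
      by simp
    have "shuffle_sign {i} U * shuffle_sign {j} (insert i U - {j}) =
       shuffle_sign {j} (U - {j}) * shuffle_sign {i} (U - {j}) * (shuffle_sign {i} {j} * shuffle_sign {j} {i})"
      unfolding 1 2 by (simp add: ac_simps)
    then show ?thesis using shuffle_sign_singletons[OF ij] by simp
  qed
  have "ext_coeff (interior v (ext_vec w * \<phi>)) U = (\<Sum>i\<in>?N - U. \<Sum>j\<in>insert i U. c i j)"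
    unfolding ext_coeff_interior[OF U]
    by (rule sum.cong)
      (use U in \<open>auto simp: ext_coeff_vec_mult c_def sum_distrib_left mult_ac intro!: sum.cong\<close>)
  also have "\<dots> = (\<Sum>i\<in>?N - U. (v \<bullet> ref_basis i) * (w \<bullet> ref_basis i) * ext_coeff \<phi> U + (\<Sum>j\<in>U. c i j))"
  proof (rule sum.cong)
    fix i assume i: "i \<in> ?N - U"
    then have "insert i U - {i} = U" by auto
    then have "c i i = (v \<bullet> ref_basis i) * (w \<bullet> ref_basis i) * ext_coeff \<phi> U"
      by (simp add: c_def shuffle_sign_square)
    then show "(\<Sum>j\<in>insert i U. c i j) =
        (v \<bullet> ref_basis i) * (w \<bullet> ref_basis i) * ext_coeff \<phi> U + (\<Sum>j\<in>U. c i j)"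
      using fin i by simp
  qed simp
  finally have L: "ext_coeff (interior v (ext_vec w * \<phi>)) U =
      (\<Sum>i\<in>?N - U. (v \<bullet> ref_basis i) * (w \<bullet> ref_basis i) * ext_coeff \<phi> U) + (\<Sum>i\<in>?N - U. \<Sum>j\<in>U. c i j)"
    by (simp add: sum.distrib)
  have "ext_coeff (ext_vec w * interior v \<phi>) U = (\<Sum>j\<in>U. \<Sum>i\<in>insert j (?N - U).
      shuffle_sign {j} (U - {j}) * shuffle_sign {i} (U - {j}) * ((v \<bullet> ref_basis i) *
        (w \<bullet> ref_basis j) * ext_coeff \<phi> (insert i (U - {j}))))"
    unfolding ext_coeff_vec_mult[OF U]
  proof (rule sum.cong)
    fix j assume j: "j \<in> U"
    then have "?N - (U - {j}) = insert j (?N - U)" "U - {j} \<subseteq> ?N" using U by auto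
    then show "shuffle_sign {j} (U - {j}) * (w \<bullet> ref_basis j) * ext_coeff (interior v \<phi>) (U - {j}) =
      (\<Sum>i\<in>insert j (?N - U). shuffle_sign {j} (U - {j}) * shuffle_sign {i} (U - {j}) *
        ((v \<bullet> ref_basis i) * (w \<bullet> ref_basis j) * ext_coeff \<phi> (insert i (U - {j}))))"
      by (simp only: ext_coeff_interior sum_distrib_left) (simp only: mult_ac)
  qed simp
  also have "\<dots> = (\<Sum>j\<in>U. (v \<bullet> ref_basis j) * (w \<bullet> ref_basis j) * ext_coeff \<phi> U - (\<Sum>i\<in>?N - U. c i j))"
  proof (rule sum.cong)
    fix j assume j: "j \<in> U"
    have "(\<Sum>i\<in>?N - U. shuffle_sign {j} (U - {j}) * shuffle_sign {i} (U - {j}) *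
        ((v \<bullet> ref_basis i) * (w \<bullet> ref_basis j) * ext_coeff \<phi> (insert i (U - {j})))) =
        (\<Sum>i\<in>?N - U. - c i j)"
    proof (rule sum.cong)
      fix i assume i: "i \<in> ?N - U"
      then have "insert i (U - {j}) = insert i U - {j}" using j by auto
      then show "shuffle_sign {j} (U - {j}) * shuffle_sign {i} (U - {j}) *
        ((v \<bullet> ref_basis i) * (w \<bullet> ref_basis j) * ext_coeff \<phi> (insert i (U - {j}))) = - c i j"
        using i j by (subst cross) (simp_all add: c_def mult_ac)
    qed simp
    then show "(\<Sum>i\<in>insert j (?N - U). shuffle_sign {j} (U - {j}) * shuffle_sign {i} (U - {j}) *
        ((v \<bullet> ref_basis i) * (w \<bullet> ref_basis j) * ext_coeff \<phi> (insert i (U - {j})))) =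
        (v \<bullet> ref_basis j) * (w \<bullet> ref_basis j) * ext_coeff \<phi> U - (\<Sum>i\<in>?N - U. c i j)"
      using j by (simp add: insert_absorb sum_negf shuffle_sign_square)
  qed simp
  finally have R: "ext_coeff (ext_vec w * interior v \<phi>) U =
      (\<Sum>j\<in>U. (v \<bullet> ref_basis j) * (w \<bullet> ref_basis j) * ext_coeff \<phi> U) - (\<Sum>i\<in>?N - U. \<Sum>j\<in>U. c i j)"
    by (subst sum.swap) (simp add: sum_subtractf)
  have "(v \<bullet> w) * ext_coeff \<phi> U = (\<Sum>j\<in>U. (v \<bullet> ref_basis j) * (w \<bullet> ref_basis j) * ext_coeff \<phi> U)
      + (\<Sum>j\<in>?N - U. (v \<bullet> ref_basis j) * (w \<bullet> ref_basis j) * ext_coeff \<phi> U)"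
    unfolding inner_eq_sum_ref_basis[of v w] sum_distrib_right
    using U by (subst sum.subset_diff[of U ?N]) (simp_all add: sum_distrib_right)
  then show "ext_coeff (interior v (ext_vec w * \<phi>)) U =
      ext_coeff ((v \<bullet> w) *\<^sub>R \<phi> - ext_vec w * interior v \<phi>) U"
    by (simp add: L R minus_ext.rep_eq scaleR_ext.rep_eq)
qed

lemma interior_one [simp]: "interior v 1 = (0 :: 'a::euclidean_space ext)"
  by (rule ext_eqI)
    (auto simp: ext_coeff_interior one_ext.rep_eq zero_ext.rep_eq intro!: sum.neutral)

lemma ext_vec_anticommute: "ext_vec v * ext_vec w = - (ext_vec w * ext_vec v)"
proof -
  have "ext_vec (v + w) * ext_vec (v + w) = 0" by (rule ext_vec_square)
  then have "ext_vec v * ext_vec w + ext_vec w * ext_vec v = 0"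
    by (simp add: linear_add[OF linear_ext_vec] algebra_simps ext_vec_square)
  then show ?thesis by (simp add: eq_neg_iff_add_eq_0)
qed

lemma ext_vec_anticommute_left: "ext_vec v * (ext_vec w * \<phi>) = - (ext_vec w * (ext_vec v * \<phi>))"
  by (simp add: mult.assoc[symmetric] ext_vec_anticommute[of v w])

lemma interior_anticommute: "interior v (interior w \<psi>) = - interior w (interior v \<psi>)"
proof -
  have "\<xi> \<bullet> interior v (interior w \<psi>) = \<xi> \<bullet> (- interior w (interior v \<psi>))" for \<xi>
    by (simp add: ext_vec_anticommute_left[of w v] flip: interior_adjoint)
  then show ?thesis by (metis vector_eq_ldot)
qed

section \<open>Induction over the exterior algebra\<close>

text \<open>Induction along increasing products of the reference basis. There the next factor \<open>v\<close> is
  orthogonal to all the previous ones, whence the additional hypothesis \<open>\<iota>\<^sub>v \<phi> = 0\<close>; it says that the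
  exterior and the Clifford product by \<open>v\<close> agree on \<open>\<phi>\<close>.\<close>

lemma ext_induct_interior:
  fixes \<phi> :: "'a::euclidean_space ext"
  assumes add: "\<And>\<phi> \<psi>. P \<phi> \<Longrightarrow> P \<psi> \<Longrightarrow> P (\<phi> + \<psi>)"
    and scale: "\<And>r \<phi>. P \<phi> \<Longrightarrow> P (r *\<^sub>R \<phi>)"
    and one: "P 1"
    and vec: "\<And>v \<phi>. P \<phi> \<Longrightarrow> interior v \<phi> = 0 \<Longrightarrow> P (ext_vec v * \<phi>)"
  shows "P \<phi>"
proof -
  have zero: "P 0" using scale[OF one, of 0] by simp
  have interior0: "interior v (wedge ws) = 0" if "\<forall>w\<in>set ws. v \<bullet> w = 0" for v :: 'a and ws
    using that by (induction ws) (simp_all add: interior_vec_mult)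
  have "P (wedge (map ref_basis is))"
    if "sorted_wrt (<) is" "set is \<subseteq> {..<DIM('a)}" for "is"
    using that
  proof (induction "is")
    case (Cons i "is")
    have "\<forall>w\<in>set (map ref_basis is). (ref_basis i :: 'a) \<bullet> w = 0"
      using Cons.prems by (auto simp: subset_eq inner_ref_basis)
    from interior0[OF this] show ?case
      using Cons by (simp add: vec)
  qed (simp add: one)
  then have basis: "P (basis_ext S)" if "S \<subseteq> {..<DIM('a)}" for S
    unfolding basis_ext_def using that finite_subset[OF that] by simp
  have "P (\<Sum>S\<in>F. ext_coeff \<phi> S *\<^sub>R basis_ext S)" if "F \<subseteq> Pow {..<DIM('a)}" for F
  proof -
    have "finite F" using that by (rule finite_subset) simp
    from this that show ?thesis
      by (induction F rule: finite_induct) (simp_all add: zero add scale basis)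
  qed
  then show ?thesis
    by (subst ext_eq_sum_basis_ext) blast
qed

lemma ext_induct [case_names add scale one vec]:
  fixes \<phi> :: "'a::euclidean_space ext"
  assumes "\<And>\<phi> \<psi>. P \<phi> \<Longrightarrow> P \<psi> \<Longrightarrow> P (\<phi> + \<psi>)"
    and "\<And>r \<phi>. P \<phi> \<Longrightarrow> P (r *\<^sub>R \<phi>)"
    and "P 1"
    and "\<And>v \<phi>. P \<phi> \<Longrightarrow> P (ext_vec v * \<phi>)"
  shows "P \<phi>"
  by (rule ext_induct_interior[of P]) (use assms in auto)

lemmas ext_vec_linear = linear_add[OF linear_ext_vec] linear_scale[OF linear_ext_vec]
  linear_sum[OF linear_ext_vec] linear_0[OF linear_ext_vec]

lemmas interior_linear = linear_add[OF linear_interior] linear_diff[OF linear_interior]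
  linear_neg[OF linear_interior] linear_scale[OF linear_interior] linear_sum[OF linear_interior]
  linear_0[OF linear_interior]

section \<open>The grading\<close>

lemma linear_ext_grade: "linear (ext_grade p)"
  by (rule linearI; rule ext_eqI) (simp_all add: ext_grade.rep_eq plus_ext.rep_eq scaleR_ext.rep_eq)

lemmas ext_grade_linear = linear_add[OF linear_ext_grade] linear_diff[OF linear_ext_grade]
  linear_neg[OF linear_ext_grade] linear_scale[OF linear_ext_grade] linear_sum[OF linear_ext_grade]
  linear_0[OF linear_ext_grade]

lemma ext_grade_one: "ext_grade p 1 = (if p = 0 then 1 else 0)"
  by (rule ext_eqI) (simp add: ext_grade.rep_eq one_ext.rep_eq zero_ext.rep_eq)

lemma ext_grade_grade: "ext_grade p (ext_grade q \<phi>) = (if p = q then ext_grade p \<phi> else 0)"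
  by (rule ext_eqI) (simp add: ext_grade.rep_eq zero_ext.rep_eq)

lemma ext_grade_adjoint: "ext_grade p \<phi> \<bullet> \<psi> = \<phi> \<bullet> ext_grade p \<psi>"
  unfolding inner_ext_def by (rule sum.cong) (simp_all add: ext_grade.rep_eq)

lemma ext_grade_vec_mult_Suc:
  "ext_grade (Suc p) (ext_vec v * \<phi>) = ext_vec v * ext_grade p \<phi>" for \<phi> :: "'a::euclidean_space ext"
proof (rule ext_eqI)
  fix U assume U: "U \<subseteq> {..<DIM('a)}"
  then have "finite U" by (rule finite_subset) simp
  then have "card (U - {i}) = p \<longleftrightarrow> card U = Suc p" if "i \<in> U" for i
    using that by (metis card_Suc_Diff1 nat.inject)
  then show "ext_coeff (ext_grade (Suc p) (ext_vec v * \<phi>)) U = ext_coeff (ext_vec v * ext_grade p \<phi>) U"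
    using U by (auto simp: ext_grade.rep_eq ext_coeff_vec_mult intro!: sum.cong)
qed

lemma ext_grade_vec_mult_0: "ext_grade 0 (ext_vec v * \<phi>) = 0" for \<phi> :: "'a::euclidean_space ext"
proof (rule ext_eqI)
  fix U assume U: "U \<subseteq> {..<DIM('a)}"
  then have "finite U" by (rule finite_subset) simp
  then show "ext_coeff (ext_grade 0 (ext_vec v * \<phi>)) U = ext_coeff 0 U"
    using U by (auto simp: ext_grade.rep_eq ext_coeff_vec_mult zero_ext.rep_eq)
qed

lemma ext_grade_interior: "ext_grade p (interior v \<phi>) = interior v (ext_grade (Suc p) \<phi>)"
proof -
  have "\<xi> \<bullet> ext_grade p (interior v \<phi>) = \<xi> \<bullet> interior v (ext_grade (Suc p) \<phi>)" for \<xi>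
    by (simp flip: ext_grade_adjoint interior_adjoint add: ext_grade_vec_mult_Suc)
  then show ?thesis by (metis vector_eq_ldot)
qed

lemma ext_grade_wedge: "ext_grade p (wedge vs) = (if length vs = p then wedge vs else 0)"
proof (induction vs arbitrary: p)
  case (Cons v vs)
  show ?case
    by (cases p) (simp_all add: ext_grade_vec_mult_0 ext_grade_vec_mult_Suc Cons)
qed (simp add: ext_grade_one)

section \<open>The Clifford product\<close>

text \<open>The sign of the Clifford product of coordinate vectors, which is
  \<open>b\<^sub>A . b\<^sub>B = cliff_sign A B \<cdot> b\<^sub>C\<close> with \<open>C\<close> the symmetric difference of \<open>A\<close> and \<open>B\<close>: there is one factor
  \<open>-1\<close> for each transposition, and one for each square \<open>b\<^sub>a . b\<^sub>a = -1\<close>. It is multiplicative in each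
  argument with respect to symmetric differences, which makes the product associative.\<close>

definition cliff_sign :: "nat set \<Rightarrow> nat set \<Rightarrow> real" where
  "cliff_sign A B = (\<Prod>a\<in>A. \<Prod>b\<in>B. if b \<le> a then - 1 else 1)"

lemma cliff_sign_empty [simp]: "cliff_sign {} B = 1" "cliff_sign A {} = 1"
  by (simp_all add: cliff_sign_def)

lemma cliff_sign_square: "cliff_sign A B * cliff_sign A B = 1"
  unfolding cliff_sign_def prod.distrib[symmetric]
  by (intro prod.neutral ballI) simp

lemma prod_sym_diff:
  fixes g :: "'b \<Rightarrow> real"
  assumes "finite A" "finite B" "\<And>x. g x * g x = 1"
  shows "prod g (sym_diff A B) = prod g A * prod g B"
proof -
  have "prod g (sym_diff A B) = prod g (A - B) * prod g (B - A)"
    using assms by (intro prod.union_disjoint) auto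
  moreover have "prod g A = prod g (A \<inter> B) * prod g (A - B)"
    using assms by (intro prod.Int_Diff)
  moreover have "prod g B = prod g (A \<inter> B) * prod g (B - A)"
    using assms prod.Int_Diff[of B g A] by (simp add: Int_commute)
  moreover have "prod g (A \<inter> B) * prod g (A \<inter> B) = 1"
    unfolding prod.distrib[symmetric] by (simp add: assms)
  ultimately show ?thesis by algebra
qed

lemma cliff_sign_sym_diff_left:
  assumes "finite A" "finite B"
  shows "cliff_sign (sym_diff A B) C = cliff_sign A C * cliff_sign B C"
  unfolding cliff_sign_def
  by (rule prod_sym_diff) (use assms in \<open>auto simp flip: prod.distrib intro!: prod.neutral\<close>)

lemma cliff_sign_sym_diff_right:
  assumes "finite B" "finite C"
  shows "cliff_sign A (sym_diff B C) = cliff_sign A B * cliff_sign A C"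
  unfolding cliff_sign_def prod.distrib[symmetric]
  by (intro prod.cong prod_sym_diff refl) (use assms in auto)

lemma cliff_sign_singleton:
  assumes "finite S" "i \<notin> S"
  shows "cliff_sign {i} S = shuffle_sign {i} S"
    and "cliff_sign {i} (insert i S) = - shuffle_sign {i} S"
proof -
  have "{(a, b) \<in> {i} \<times> S. b < a} = Pair i ` {b \<in> S. b < i}" by auto
  then have "shuffle_sign {i} S = (- 1) ^ card {b \<in> S. b < i}"
    unfolding shuffle_sign_def by (simp add: card_image inj_on_def)
  also have "\<dots> = (\<Prod>b\<in>{b \<in> S. b < i}. - 1)" by simp
  also have "\<dots> = (\<Prod>b\<in>S. if b < i then - 1 else 1)"
    using assms by (subst prod.inter_filter) simp_all
  also have "\<dots> = (\<Prod>b\<in>S. if b \<le> i then - 1 else 1)"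
    by (rule prod.cong) (use assms(2) in \<open>auto simp: order_le_less\<close>)
  finally have *: "shuffle_sign {i} S = (\<Prod>b\<in>S. if b \<le> i then - 1 else 1)" .
  then show "cliff_sign {i} S = shuffle_sign {i} S" by (simp add: cliff_sign_def)
  show "cliff_sign {i} (insert i S) = - shuffle_sign {i} S"
    unfolding * using assms by (simp add: cliff_sign_def)
qed

text \<open>The Clifford product in coordinates, as a group algebra of sets under symmetric difference,
  twisted by \<open>cliff_sign\<close>.\<close>

lift_definition clifford_coord :: "'a::euclidean_space ext \<Rightarrow> 'a ext \<Rightarrow> 'a ext" is
  "\<lambda>f h U. if U \<subseteq> {..<DIM('a)} then
    (\<Sum>S\<in>Pow {..<DIM('a)}. cliff_sign S (sym_diff S U) * f S * h (sym_diff S U)) else 0"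
  by simp

lemma bilinear_clifford_coord: "bilinear clifford_coord"
  unfolding bilinear_def
  by (intro conjI allI; rule linearI; rule ext_eqI)
    (simp_all add: clifford_coord.rep_eq plus_ext.rep_eq scaleR_ext.rep_eq sum.distrib
      sum_distrib_left algebra_simps)

lemma clifford_coord_assoc:
  "clifford_coord (clifford_coord \<phi> \<psi>) \<xi> = clifford_coord \<phi> (clifford_coord \<psi> \<xi>)"
  for \<phi> \<psi> \<xi> :: "'a::euclidean_space ext"
proof (rule ext_eqI)
  let ?N = "{..<DIM('a)}"
  have fin: "finite S" if "S \<subseteq> ?N" for S using that by (rule finite_subset) simp
  fix U assume U: "U \<subseteq> ?N"
  have "ext_coeff (clifford_coord (clifford_coord \<phi> \<psi>) \<xi>) U = (\<Sum>S\<in>Pow ?N. \<Sum>R\<in>Pow ?N.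
      cliff_sign S (sym_diff S U) * cliff_sign R (sym_diff R S) *
      (ext_coeff \<phi> R * ext_coeff \<psi> (sym_diff R S) * ext_coeff \<xi> (sym_diff S U)))"
    using U by (auto simp: clifford_coord.rep_eq sum_distrib_left sum_distrib_right mult_ac
        intro!: sum.cong)
  also have "\<dots> = (\<Sum>R\<in>Pow ?N. \<Sum>S\<in>Pow ?N.
      cliff_sign S (sym_diff S U) * cliff_sign R (sym_diff R S) *
      (ext_coeff \<phi> R * ext_coeff \<psi> (sym_diff R S) * ext_coeff \<xi> (sym_diff S U)))"
    by (rule sum.swap)
  also have "\<dots> = (\<Sum>R\<in>Pow ?N. \<Sum>T\<in>Pow ?N.
      cliff_sign R (sym_diff R U) * cliff_sign T (sym_diff T (sym_diff R U)) *
      (ext_coeff \<phi> R * ext_coeff \<psi> T * ext_coeff \<xi> (sym_diff T (sym_diff R U))))"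
  proof (rule sum.cong[OF refl])
    fix R assume R: "R \<in> Pow ?N"
    show "(\<Sum>S\<in>Pow ?N. cliff_sign S (sym_diff S U) * cliff_sign R (sym_diff R S) *
        (ext_coeff \<phi> R * ext_coeff \<psi> (sym_diff R S) * ext_coeff \<xi> (sym_diff S U))) =
      (\<Sum>T\<in>Pow ?N. cliff_sign R (sym_diff R U) * cliff_sign T (sym_diff T (sym_diff R U)) *
        (ext_coeff \<phi> R * ext_coeff \<psi> T * ext_coeff \<xi> (sym_diff T (sym_diff R U))))"
    proof (rule sum.reindex_bij_witness[where i = "sym_diff R" and j = "sym_diff R"], goal_cases)
      case (5 S)
      have f: "finite R" "finite S" "finite U" using fin R 5 U by auto
      have S: "sym_diff (sym_diff R S) (sym_diff R U) = sym_diff S U" by auto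
      have "cliff_sign R (sym_diff R U) * cliff_sign R (sym_diff S U) = cliff_sign R (sym_diff R S)"
        using f cliff_sign_square[of R U]
        by (simp add: cliff_sign_sym_diff_right)
      then have "cliff_sign S (sym_diff S U) * cliff_sign R (sym_diff R S) =
        cliff_sign R (sym_diff R U) * cliff_sign (sym_diff R S) (sym_diff S U)"
        using f by (simp add: cliff_sign_sym_diff_left)
      then show ?case by (simp only: S)
    qed (use R in auto)
  qed
  also have "\<dots> = ext_coeff (clifford_coord \<phi> (clifford_coord \<psi> \<xi>)) U"
    using U by (auto simp: clifford_coord.rep_eq sum_distrib_left sum_distrib_right mult_ac
        intro!: sum.cong)
  finally show "ext_coeff (clifford_coord (clifford_coord \<phi> \<psi>) \<xi>) U =
    ext_coeff (clifford_coord \<phi> (clifford_coord \<psi> \<xi>)) U" .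
qed

lemma clifford_coord_one_left: "clifford_coord 1 \<psi> = \<psi>" for \<psi> :: "'a::euclidean_space ext"
proof (rule ext_eqI)
  fix U assume U: "U \<subseteq> {..<DIM('a)}"
  have "cliff_sign S (sym_diff S U) * ext_coeff (1 :: 'a ext) S * ext_coeff \<psi> (sym_diff S U) =
      (if S = {} then ext_coeff \<psi> U else 0)" for S
    by (simp add: one_ext.rep_eq)
  then show "ext_coeff (clifford_coord 1 \<psi>) U = ext_coeff \<psi> U"
    using U by (simp only: clifford_coord.rep_eq) simp
qed

lemma clifford_coord_one_right: "clifford_coord \<psi> 1 = \<psi>" for \<psi> :: "'a::euclidean_space ext"
proof (rule ext_eqI)
  fix U assume U: "U \<subseteq> {..<DIM('a)}"
  have "sym_diff S U = {} \<longleftrightarrow> S = U" for S by auto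
  then have "cliff_sign S (sym_diff S U) * ext_coeff \<psi> S * ext_coeff (1 :: 'a ext) (sym_diff S U) =
      (if S = U then ext_coeff \<psi> U else 0)" for S
    by (simp only: one_ext.rep_eq) simp
  then show "ext_coeff (clifford_coord \<psi> 1) U = ext_coeff \<psi> U"
    using U by (simp only: clifford_coord.rep_eq) simp
qed

lemma clifford_coord_vec:
  "clifford_coord (ext_vec v) \<psi> = ext_vec v * \<psi> - interior v \<psi>" for \<psi> :: "'a::euclidean_space ext"
proof (rule ext_eqI)
  let ?N = "{..<DIM('a)}"
  fix U assume U: "U \<subseteq> ?N"
  have fin: "finite U" using U by (rule finite_subset) simp
  let ?t = "\<lambda>S. cliff_sign S (sym_diff S U) * ext_coeff (ext_vec v) S * ext_coeff \<psi> (sym_diff S U)"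
  have "ext_coeff (clifford_coord (ext_vec v) \<psi>) U = (\<Sum>S\<in>Pow ?N. ?t S)"
    using U by (simp add: clifford_coord.rep_eq)
  also have "\<dots> = (\<Sum>S\<in>(\<lambda>i. {i}) ` ?N. ?t S)"
  proof (rule sum.mono_neutral_right)
    show "\<forall>S\<in>Pow ?N - (\<lambda>i. {i}) ` ?N. ?t S = 0"
    proof
      fix S assume "S \<in> Pow ?N - (\<lambda>i. {i}) ` ?N"
      then have "ext_coeff (ext_vec v) S = 0"
        by (intro ext_coeff_vec_other) blast
      then show "?t S = 0" by simp
    qed
  qed auto
  also have "\<dots> = (\<Sum>i\<in>?N. ?t {i})"
    by (subst sum.reindex) (auto simp: inj_on_def)
  also have "\<dots> = (\<Sum>i\<in>?N - U. ?t {i}) + (\<Sum>i\<in>U. ?t {i})"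
    using U by (intro sum.subset_diff) auto
  also have "(\<Sum>i\<in>?N - U. ?t {i}) = - ext_coeff (interior v \<psi>) U"
    unfolding ext_coeff_interior[OF U] sum_negf[symmetric]
  proof (rule sum.cong[OF refl])
    fix i assume i: "i \<in> ?N - U"
    then have eq: "sym_diff {i} U = insert i U" by auto
    show "?t {i} = - (shuffle_sign {i} U * (v \<bullet> ref_basis i) * ext_coeff \<psi> (insert i U))"
      unfolding eq using i fin by (simp add: cliff_sign_singleton ext_coeff_vec_singleton)
  qed
  also have "(\<Sum>i\<in>U. ?t {i}) = ext_coeff (ext_vec v * \<psi>) U"
    unfolding ext_coeff_vec_mult[OF U]
  proof (rule sum.cong[OF refl])
    fix i assume i: "i \<in> U"
    then have eq: "sym_diff {i} U = U - {i}" and "i < DIM('a)" using U by auto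
    then show "?t {i} = shuffle_sign {i} (U - {i}) * (v \<bullet> ref_basis i) * ext_coeff \<psi> (U - {i})"
      unfolding eq using fin cliff_sign_singleton(1)[of "U - {i}" i]
      by (simp add: ext_coeff_vec_singleton)
  qed
  finally show "ext_coeff (clifford_coord (ext_vec v) \<psi>) U = ext_coeff (ext_vec v * \<psi> - interior v \<psi>) U"
    by (simp add: minus_ext.rep_eq)
qed

text \<open>Two products with the properties of the Clifford product agree: by associativity and
  \<open>ext_induct_interior\<close>, the left factor can be reduced to vectors.\<close>

lemma clifford_eq_coord: "clifford = (clifford_coord :: 'a::euclidean_space ext \<Rightarrow> 'a ext \<Rightarrow> 'a ext)"
  unfolding clifford_def
proof (rule the_equality)
  show "bilinear clifford_coord \<and>
    (\<forall>\<phi> \<psi> \<xi> :: 'a ext. clifford_coord (clifford_coord \<phi> \<psi>) \<xi> = clifford_coord \<phi> (clifford_coord \<psi> \<xi>)) \<and>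
    (\<forall>\<psi> :: 'a ext. clifford_coord 1 \<psi> = \<psi> \<and> clifford_coord \<psi> 1 = \<psi>) \<and>
    (\<forall>v (\<psi> :: 'a ext). clifford_coord (ext_vec v) \<psi> = ext_vec v * \<psi> - interior v \<psi>)"
    by (intro conjI allI bilinear_clifford_coord clifford_coord_assoc clifford_coord_one_left
        clifford_coord_one_right clifford_coord_vec)
next
  fix m :: "'a ext \<Rightarrow> 'a ext \<Rightarrow> 'a ext"
  assume "bilinear m \<and> (\<forall>\<phi> \<psi> \<xi>. m (m \<phi> \<psi>) \<xi> = m \<phi> (m \<psi> \<xi>)) \<and>
    (\<forall>\<psi>. m 1 \<psi> = \<psi> \<and> m \<psi> 1 = \<psi>) \<and>
    (\<forall>v \<psi>. m (ext_vec v) \<psi> = ext_vec v * \<psi> - interior v \<psi>)"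
  then have lin: "bilinear m" and assoc: "\<And>\<phi> \<psi> \<xi>. m (m \<phi> \<psi>) \<xi> = m \<phi> (m \<psi> \<xi>)"
    and one: "\<And>\<psi>. m 1 \<psi> = \<psi>" and vec: "\<And>v \<psi>. m (ext_vec v) \<psi> = ext_vec v * \<psi> - interior v \<psi>"
    by auto
  have "\<forall>\<psi>. m \<phi> \<psi> = clifford_coord \<phi> \<psi>" for \<phi>
  proof (induction \<phi> rule: ext_induct_interior)
    case (4 v \<phi>)
    have "m (m (ext_vec v) \<phi>) \<xi> = clifford_coord (clifford_coord (ext_vec v) \<phi>) \<xi>" for \<xi>
      unfolding assoc clifford_coord_assoc using 4 by (simp add: vec clifford_coord_vec)
    then show ?case
      using 4(2) by (simp add: vec clifford_coord_vec)
  qed (simp_all add: one clifford_coord_one_left bilinear_ladd[OF lin] bilinear_lmul[OF lin]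
      bilinear_ladd[OF bilinear_clifford_coord] bilinear_lmul[OF bilinear_clifford_coord])
  then show "m = clifford_coord" by (intro HOL.ext) simp
qed

lemmas bilinear_clifford = bilinear_clifford_coord[folded clifford_eq_coord]
lemmas clifford_assoc = clifford_coord_assoc[folded clifford_eq_coord]
lemmas clifford_one_left = clifford_coord_one_left[folded clifford_eq_coord]
lemmas clifford_one_right = clifford_coord_one_right[folded clifford_eq_coord]
lemmas clifford_vec = clifford_coord_vec[folded clifford_eq_coord]

lemmas clifford_linear =
  bilinear_ladd[OF bilinear_clifford] bilinear_radd[OF bilinear_clifford]
  bilinear_lsub[OF bilinear_clifford] bilinear_rsub[OF bilinear_clifford]
  bilinear_lneg[OF bilinear_clifford] bilinear_rneg[OF bilinear_clifford]
  bilinear_lmul[OF bilinear_clifford] bilinear_rmul[OF bilinear_clifford]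

lemma ext_induct_clifford:
  fixes \<phi> :: "'a::euclidean_space ext"
  assumes "\<And>\<phi> \<psi>. P \<phi> \<Longrightarrow> P \<psi> \<Longrightarrow> P (\<phi> + \<psi>)"
    and "\<And>r \<phi>. P \<phi> \<Longrightarrow> P (r *\<^sub>R \<phi>)"
    and "P 1"
    and "\<And>v \<phi>. P \<phi> \<Longrightarrow> P (clifford (ext_vec v) \<phi>)"
  shows "P \<phi>"
proof (induction \<phi> rule: ext_induct_interior)
  case (4 v \<phi>)
  then show ?case using assms(4)[of \<phi> v] by (simp add: clifford_vec)
qed (use assms in auto)

lemma clifford_vec_anticommute:
  "clifford (ext_vec v) (ext_vec w) = - clifford (ext_vec w) (ext_vec v) - (2 * (v \<bullet> w)) *\<^sub>R 1"
proof -
  have *: "interior v (ext_vec w) = (v \<bullet> w) *\<^sub>R 1" for v w :: 'a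
    using interior_vec_mult[of v w 1] by simp
  have "(2 * r) *\<^sub>R x = r *\<^sub>R x + r *\<^sub>R x" for r and x :: "'a ext"
    by (simp only: mult_2 scaleR_left_distrib)
  then show ?thesis
    by (simp add: clifford_vec * ext_vec_anticommute[of v w] inner_commute[of w v])
qed

text \<open>Both sides vanish at \<open>1\<close>, and both have the same commutator with the Clifford multiplication by
  a vector \<open>w\<close>, namely multiplication by \<open>2 (\<langle>u, w\<rangle> v - \<langle>v, w\<rangle> u)\<close>.\<close>

lemma clifford_ad_vec_vec:
  fixes \<psi> :: "'a::euclidean_space ext"
  shows "clifford_ad (clifford (ext_vec u) (ext_vec v)) \<psi> =
    2 *\<^sub>R (ext_vec v * interior u \<psi> - ext_vec u * interior v \<psi>)"
proof (induction \<psi> rule: ext_induct_clifford)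
  case (4 w \<psi>)
  let ?c = "\<lambda>v. clifford (ext_vec v)"
  let ?u = "ext_vec u" and ?v = "ext_vec v" and ?w = "ext_vec w"
  have "clifford (?c u ?v) ?w = clifford ?w (?c u ?v) + (2 * (u \<bullet> w)) *\<^sub>R ?v - (2 * (v \<bullet> w)) *\<^sub>R ?u"
  proof -
    have "clifford (?c u ?v) ?w = - clifford (?c u ?w) ?v - (2 * (v \<bullet> w)) *\<^sub>R ?u"
      by (simp add: clifford_assoc clifford_vec_anticommute[of v w] clifford_linear clifford_one_right)
    also have "clifford (?c u ?w) ?v = - clifford ?w (?c u ?v) - (2 * (u \<bullet> w)) *\<^sub>R ?v"
      by (simp add: clifford_vec_anticommute[of u w] clifford_linear clifford_one_left clifford_assoc)
    finally show ?thesis by simp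
  qed
  then have "clifford_ad (?c u ?v) (?c w \<psi>) = ?c w (clifford_ad (?c u ?v) \<psi>) +
      (2 * (u \<bullet> w)) *\<^sub>R ?c v \<psi> - (2 * (v \<bullet> w)) *\<^sub>R ?c u \<psi>"
    unfolding clifford_ad_def
    by (simp add: clifford_linear flip: clifford_assoc)
  also have "\<dots> = 2 *\<^sub>R (?v * interior u (?c w \<psi>) - ?u * interior v (?c w \<psi>))"
    unfolding 4
    by (simp add: clifford_vec interior_linear interior_vec_mult algebra_simps
        ext_vec_anticommute_left[of w u] ext_vec_anticommute_left[of w v]
        interior_anticommute[of w u] interior_anticommute[of w v]
        inner_commute[of w u] inner_commute[of w v])
  finally show ?case .
next
  case (2 r \<psi>)
  have "clifford_ad \<phi> (r *\<^sub>R \<psi>) = r *\<^sub>R clifford_ad \<phi> \<psi>" for \<phi>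
    by (simp add: clifford_ad_def clifford_linear scaleR_right_diff_distrib)
  then show ?case by (simp add: 2 interior_linear algebra_simps)
qed (simp_all add: clifford_ad_def clifford_linear interior_linear clifford_one_left clifford_one_right
    algebra_simps)

section \<open>Interior multiplication of decomposable elements\<close>

text \<open>Iterated interior multiplication \<open>\<iota>\<^bsub>v\<^sub>p\<^esub> \<dots> \<iota>\<^bsub>v\<^sub>1\<^esub>\<close> by a list of vectors; the first one acts first.\<close>

primrec interiors :: "'a::euclidean_space list \<Rightarrow> 'a ext \<Rightarrow> 'a ext" where
  "interiors [] \<phi> = \<phi>"
| "interiors (v # vs) \<phi> = interiors vs (interior v \<phi>)"

lemma interiors_snoc: "interiors (vs @ [v]) \<phi> = interior v (interiors vs \<phi>)"
  by (induction vs arbitrary: \<phi>) simp_all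

lemma linear_interiors: "linear (interiors vs)"
proof (induction vs)
  case Nil
  show ?case by (rule linearI) simp_all
next
  case (Cons v vs)
  show ?case
    by (rule linearI) (simp_all add: interior_linear linear_add[OF Cons] linear_scale[OF Cons])
qed

lemma ext_grade_interiors: "ext_grade r (interiors vs \<phi>) = interiors vs (ext_grade (length vs + r) \<phi>)"
  by (induction vs arbitrary: \<phi>) (simp_all add: ext_grade_interior)

lemma interior_wedge:
  "interior v (wedge ws) =
    (\<Sum>k<length ws. ((- 1) ^ k * (v \<bullet> ws ! k)) *\<^sub>R wedge (take k ws @ drop (Suc k) ws))"
proof (induction ws)
  case (Cons w ws)
  have "interior v (wedge (w # ws)) = (v \<bullet> w) *\<^sub>R wedge ws - ext_vec w * interior v (wedge ws)"
    by (simp add: interior_vec_mult)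
  also have "\<dots> = (v \<bullet> w) *\<^sub>R wedge ws + (\<Sum>k<length ws. ((- 1) ^ Suc k * (v \<bullet> (w # ws) ! Suc k)) *\<^sub>R
      wedge (take (Suc k) (w # ws) @ drop (Suc (Suc k)) (w # ws)))"
    unfolding Cons by (simp add: sum_distrib_left sum_negf)
  also have "\<dots> = (\<Sum>k<length (w # ws). ((- 1) ^ k * (v \<bullet> (w # ws) ! k)) *\<^sub>R
      wedge (take k (w # ws) @ drop (Suc k) (w # ws)))"
    by (simp only: length_Cons sum.lessThan_Suc_shift) simp
  finally show ?case .
qed simp

text \<open>The sum of \<open>sign \<sigma> \<cdot> h (x \<circ> \<sigma>)\<close> over all permutations \<open>\<sigma>\<close> of the indices below \<open>n\<close>.\<close>

definition alternation :: "nat \<Rightarrow> ((nat \<Rightarrow> 'a) \<Rightarrow> 'b) \<Rightarrow> (nat \<Rightarrow> 'a) \<Rightarrow> 'b::real_vector" where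
  "alternation n h x = (\<Sum>\<sigma> | \<sigma> permutes {..<n}. of_int (sign \<sigma>) *\<^sub>R h (x \<circ> \<sigma>))"

lemma alternation_transpose:
  assumes "a < n" "b < n" "a \<noteq> b"
  shows "alternation n (\<lambda>y. h (y \<circ> Transposition.transpose a b)) x = - alternation n h x"
proof -
  let ?t = "Transposition.transpose a b"
  have t: "?t permutes {..<n}" using assms by (intro permutes_swap_id) auto
  have "alternation n h x = (\<Sum>\<sigma> | \<sigma> permutes {..<n}. of_int (sign (\<sigma> \<circ> ?t)) *\<^sub>R h (x \<circ> (\<sigma> \<circ> ?t)))"
    unfolding alternation_def by (rule sum_permutations_compose_right[OF t])
  also have "\<dots> = (\<Sum>\<sigma> | \<sigma> permutes {..<n}. - (of_int (sign \<sigma>) *\<^sub>R h (x \<circ> \<sigma> \<circ> ?t)))"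
  proof (rule sum.cong[OF refl])
    fix \<sigma> assume "\<sigma> \<in> {\<sigma>. \<sigma> permutes {..<n}}"
    then have "permutation \<sigma>" by (auto intro: permutes_imp_permutation[of "{..<n}"])
    then have "sign (\<sigma> \<circ> ?t) = - sign \<sigma>"
      using assms by (simp add: sign_compose permutation_swap_id sign_swap_id)
    then show "of_int (sign (\<sigma> \<circ> ?t)) *\<^sub>R h (x \<circ> (\<sigma> \<circ> ?t)) = - (of_int (sign \<sigma>) *\<^sub>R h (x \<circ> \<sigma> \<circ> ?t))"
      by (simp add: comp_assoc)
  qed
  finally show ?thesis by (simp add: alternation_def sum_negf)
qed

lemma ext_vec_mult_wedge: "ext_vec v * wedge ws = (- 1) ^ length ws * (wedge ws * ext_vec v)"
proof (induction ws)
  case (Cons w ws)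
  have "ext_vec v * wedge (w # ws) = - (ext_vec w * (ext_vec v * wedge ws))"
    by (simp add: ext_vec_anticommute_left[of v])
  also have "\<dots> = (- 1) ^ length (w # ws) * (wedge (w # ws) * ext_vec v)"
    unfolding Cons by (cases "even (length ws)") (simp_all add: mult.assoc)
  finally show ?case .
qed simp

lemma wedge_swap: "wedge (us @ v # ws @ w # zs) = - wedge (us @ w # ws @ v # zs)"
proof -
  have *: "ext_vec v * (wedge ws * (ext_vec w * \<phi>)) = - (ext_vec w * (wedge ws * (ext_vec v * \<phi>)))" for \<phi>
  proof -
    have "ext_vec v * (wedge ws * (ext_vec w * \<phi>)) = (ext_vec v * wedge ws) * (ext_vec w * \<phi>)"
      by (simp add: mult.assoc)
    also have "\<dots> = (- 1) ^ length ws * (wedge ws * (ext_vec v * (ext_vec w * \<phi>)))"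
      by (simp add: ext_vec_mult_wedge mult.assoc)
    also have "\<dots> = - ((- 1) ^ length ws * (wedge ws * (ext_vec w * (ext_vec v * \<phi>))))"
      by (simp add: ext_vec_anticommute_left[of v w])
    also have "\<dots> = - ((ext_vec w * wedge ws) * (ext_vec v * \<phi>))"
      by (simp add: ext_vec_mult_wedge mult.assoc)
    finally show ?thesis by (simp add: mult.assoc)
  qed
  show ?thesis by (simp add: * mult.assoc)
qed

lemma wedge_transpose:
  assumes "a < n" "b < n" "a \<noteq> b"
  shows "wedge (map (x \<circ> Transposition.transpose a b) [0..<n]) = - wedge (map x [0..<n])"
proof -
  have less: "wedge (map (x \<circ> Transposition.transpose a b) [0..<n]) = - wedge (map x [0..<n])"
    if "a < b" "b < n" for a b
  proof -
    have split: "[0..<n] = [0..<a] @ a # [Suc a..<b] @ b # [Suc b..<n]"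
      using that upt_add_eq_append[of 0 a "n - a"] upt_add_eq_append[of "Suc a" b "n - b"]
      by (simp add: upt_conv_Cons)
    have outside: "map (x \<circ> Transposition.transpose a b) is = map x is" if "a \<notin> set is" "b \<notin> set is" for "is"
      using that by (intro map_cong refl) (auto simp: Transposition.transpose_def)
    have "map (x \<circ> Transposition.transpose a b) [0..<n] = map x [0..<a] @ x b # map x [Suc a..<b] @ x a # map x [Suc b..<n]"
      unfolding split using that by (simp add: outside del: o_apply) simp
    also have "wedge \<dots> = - wedge (map x [0..<a] @ x a # map x [Suc a..<b] @ x b # map x [Suc b..<n])"
      by (rule wedge_swap)
    also have "map x [0..<a] @ x a # map x [Suc a..<b] @ x b # map x [Suc b..<n] = map x [0..<n]"
      unfolding split by simp
    finally show ?thesis .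
  qed
  show ?thesis
  proof (cases "a < b")
    case False
    then show ?thesis using less[of b a] assms by (simp add: Transposition.transpose_commute)
  qed (use less assms in auto)
qed

lemma wedge_permute:
  assumes "\<sigma> permutes {..<n}"
  shows "wedge (map (x \<circ> \<sigma>) [0..<n]) = of_int (sign \<sigma>) *\<^sub>R wedge (map x [0..<n])"
proof -
  have "finite {..<n}" by simp
  from this assms show ?thesis
  proof (induction rule: permutes_rev_induct)
    case (swap a b \<sigma>)
    have "permutation \<sigma>" using swap by (auto intro: permutes_imp_permutation[of "{..<n}"])
    then have "sign (\<sigma> \<circ> Transposition.transpose a b) = - sign \<sigma>"
      using swap by (simp add: sign_compose permutation_swap_id sign_swap_id)
    moreover have "wedge (map (x \<circ> \<sigma> \<circ> Transposition.transpose a b) [0..<n]) = - wedge (map (x \<circ> \<sigma>) [0..<n])"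
      using swap by (intro wedge_transpose) auto
    ultimately show ?case
      unfolding comp_assoc[symmetric] by (simp only: swap of_int_minus scaleR_minus_left)
  qed simp
qed

lemma alternation_wedge: "alternation n (\<lambda>y. wedge (map y [0..<n])) x = fact n *\<^sub>R wedge (map x [0..<n])"
proof -
  have "alternation n (\<lambda>y. wedge (map y [0..<n])) x =
      (\<Sum>\<sigma> | \<sigma> permutes {..<n}. wedge (map x [0..<n]))"
    unfolding alternation_def
  proof (rule sum.cong[OF refl])
    fix \<sigma> assume "\<sigma> \<in> {\<sigma>. \<sigma> permutes {..<n}}"
    then have "wedge (map (x \<circ> \<sigma>) [0..<n]) = of_int (sign \<sigma>) *\<^sub>R wedge (map x [0..<n])"
      by (intro wedge_permute) simp
    moreover have "(of_int (sign \<sigma>) :: real) * of_int (sign \<sigma>) = 1"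
      by (simp add: sign_def)
    ultimately show "of_int (sign \<sigma>) *\<^sub>R wedge (map (x \<circ> \<sigma>) [0..<n]) = wedge (map x [0..<n])"
      by simp
  qed
  also have "\<dots> = fact n *\<^sub>R wedge (map x [0..<n])"
    by (simp add: card_permutations[of "{..<n}" n] scaleR_conv_of_real)
  finally show ?thesis .
qed

text \<open>By the Leibniz rule, interior multiplication removes one of the \<open>n - p\<close> factors. Adjacent
  transpositions move the removed factor to position \<open>p\<close> and absorb the sign, so that all these terms
  have the same alternating sum. The weight \<open>g\<close> stands for the factors removed before; it depends only
  on the vectors with index below \<open>p\<close>.\<close>

lemma interior_alternation:
  assumes p: "p < n"
    and g: "\<And>y i. p \<le> i \<Longrightarrow> g (y \<circ> Transposition.transpose i (Suc i)) = g y"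
  shows "interior v (alternation n (\<lambda>y. g y *\<^sub>R wedge (map y [p..<n])) x) =
    real (n - p) *\<^sub>R alternation n (\<lambda>y. (g y * (v \<bullet> y p)) *\<^sub>R wedge (map y [Suc p..<n])) x"
proof -
  \<comment> \<open>The term in which the factor with index \<open>p + k\<close> is removed, up to sign.\<close>
  define h where "h k y = (g y * (v \<bullet> y (p + k))) *\<^sub>R wedge (map y ([p..<p + k] @ [Suc (p + k)..<n]))" for k y
  have h_Suc: "h (Suc k) y = h k (y \<circ> Transposition.transpose (p + k) (Suc (p + k)))" if k: "Suc (p + k) < n" for k y
  proof -
    let ?t = "Transposition.transpose (p + k) (Suc (p + k))"
    have outside: "map (y \<circ> ?t) is = map y is" if "p + k \<notin> set is" "Suc (p + k) \<notin> set is" for "is"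
      using that by (intro map_cong refl) (auto simp: Transposition.transpose_def)
    have "map (y \<circ> ?t) ([p..<p + k] @ [Suc (p + k)..<n]) =
        map (y \<circ> ?t) [p..<p + k] @ y (p + k) # map (y \<circ> ?t) [Suc (Suc (p + k))..<n]"
      using k by (simp add: upt_conv_Cons)
    also have "\<dots> = map y [p..<p + k] @ y (p + k) # map y [Suc (Suc (p + k))..<n]"
      using outside[of "[p..<p + k]"] outside[of "[Suc (Suc (p + k))..<n]"] by simp
    also have "\<dots> = map y ([p..<p + Suc k] @ [Suc (p + Suc k)..<n])"
      by simp
    finally have "map (y \<circ> ?t) ([p..<p + k] @ [Suc (p + k)..<n]) =
        map y ([p..<p + Suc k] @ [Suc (p + Suc k)..<n])" .
    then show ?thesis using g[of "p + k" y] unfolding h_def by (simp only: o_apply Transposition.transpose_apply_first add_Suc_right)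
  qed
  have alt: "alternation n (h k) x = (- 1) ^ k *\<^sub>R alternation n (h 0) x" if "p + k < n" for k
    using that
  proof (induction k)
    case (Suc k)
    have "alternation n (h (Suc k)) x = alternation n (\<lambda>y. h k (y \<circ> Transposition.transpose (p + k) (Suc (p + k)))) x"
      using Suc.prems by (simp add: h_Suc alternation_def)
    also have "\<dots> = - alternation n (h k) x"
      using Suc.prems by (intro alternation_transpose) auto
    finally show ?case using Suc by simp
  qed simp
  have one: "interior v (g y *\<^sub>R wedge (map y [p..<n])) = (\<Sum>k<n - p. (- 1) ^ k *\<^sub>R h k y)" for y
  proof -
    have *: "wedge (take k (map y [p..<n]) @ drop (Suc k) (map y [p..<n])) =
        wedge (map y ([p..<p + k] @ [Suc (p + k)..<n]))" if "k < n - p" for k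
      using that by (simp add: take_map drop_map take_upt)
    show ?thesis
      unfolding interior_linear interior_wedge scaleR_sum_right
    proof (rule sum.cong)
      fix k assume "k \<in> {..<n - p}"
      then have k: "k < n - p" by simp
      then have nth: "map y [p..<n] ! k = y (p + k)" by simp
      show "g y *\<^sub>R ((- 1) ^ k * (v \<bullet> map y [p..<n] ! k)) *\<^sub>R
          wedge (take k (map y [p..<n]) @ drop (Suc k) (map y [p..<n])) = (- 1) ^ k *\<^sub>R h k y"
        unfolding h_def *[OF k] nth scaleR_scaleR by (simp only: mult.left_commute)
    qed simp
  qed
  have "interior v (alternation n (\<lambda>y. g y *\<^sub>R wedge (map y [p..<n])) x) =
      (\<Sum>\<sigma> | \<sigma> permutes {..<n}. \<Sum>k<n - p. (- 1) ^ k *\<^sub>R (of_int (sign \<sigma>) *\<^sub>R h k (x \<circ> \<sigma>)))"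
    unfolding alternation_def linear_sum[OF linear_interior] linear_scale[OF linear_interior, of _ "of_int (sign _)"] one
    by (simp add: scaleR_sum_right mult.commute)
  also have "\<dots> = (\<Sum>k<n - p. (- 1) ^ k *\<^sub>R alternation n (h k) x)"
    by (subst sum.swap) (simp add: alternation_def scaleR_sum_right)
  also have "\<dots> = (\<Sum>k<n - p. alternation n (h 0) x)"
  proof (rule sum.cong[OF refl])
    fix k assume "k \<in> {..<n - p}"
    then have "alternation n (h k) x = (- 1) ^ k *\<^sub>R alternation n (h 0) x" by (intro alt) simp
    then show "(- 1) ^ k *\<^sub>R alternation n (h k) x = alternation n (h 0) x" by simp
  qed
  also have "\<dots> = real (n - p) *\<^sub>R alternation n (h 0) x"
    by (simp only: sum_constant_scaleR card_lessThan)
  also have "h 0 = (\<lambda>y. (g y * (v \<bullet> y p)) *\<^sub>R wedge (map y [Suc p..<n]))"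
    by (rule HOL.ext) (simp add: h_def)
  finally show ?thesis .
qed

text \<open>The iterated interior product of a decomposable element is a sum over permutations. The product
  of double forms is defined by two such sums, one for each argument.\<close>

lemma interiors_wedge:
  assumes "length vs \<le> n"
  shows "interiors vs (wedge (map x [0..<n])) = (1 / fact (n - length vs)) *\<^sub>R
    alternation n (\<lambda>y. (\<Prod>i<length vs. vs ! i \<bullet> y i) *\<^sub>R wedge (map y [length vs..<n])) x"
  using assms
proof (induction vs rule: rev_induct)
  case Nil
  show ?case using alternation_wedge[of n x] by (simp del: map_map)
next
  case (snoc v vs)
  let ?m = "length vs"
  let ?g = "\<lambda>y. \<Prod>i<?m. vs ! i \<bullet> y i"
  have m: "?m < n" using snoc.prems by simp
  have "interiors (vs @ [v]) (wedge (map x [0..<n])) = (1 / fact (n - ?m)) *\<^sub>R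
      interior v (alternation n (\<lambda>y. ?g y *\<^sub>R wedge (map y [?m..<n])) x)"
    using snoc m by (simp only: interiors_snoc) (simp add: interior_linear)
  also have "interior v (alternation n (\<lambda>y. ?g y *\<^sub>R wedge (map y [?m..<n])) x) =
      real (n - ?m) *\<^sub>R alternation n (\<lambda>y. (?g y * (v \<bullet> y ?m)) *\<^sub>R wedge (map y [Suc ?m..<n])) x"
    by (rule interior_alternation[OF m]) (auto simp: Transposition.transpose_def intro!: prod.cong)
  also have "(1 / fact (n - ?m)) *\<^sub>R (real (n - ?m) *\<^sub>R alternation n (\<lambda>y. (?g y * (v \<bullet> y ?m)) *\<^sub>R wedge (map y [Suc ?m..<n])) x)
      = (1 / fact (n - Suc ?m)) *\<^sub>R alternation n (\<lambda>y. (?g y * (v \<bullet> y ?m)) *\<^sub>R wedge (map y [Suc ?m..<n])) x"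
  proof -
    have "n - ?m = Suc (n - Suc ?m)" using m by simp
    then have "fact (n - ?m) = real (n - ?m) * fact (n - Suc ?m)" by (metis fact_Suc)
    then show ?thesis using m by simp
  qed
  also have "(\<lambda>y. (?g y * (v \<bullet> y ?m)) *\<^sub>R wedge (map y [Suc ?m..<n])) =
    (\<lambda>y. (\<Prod>i<length (vs @ [v]). (vs @ [v]) ! i \<bullet> y i) *\<^sub>R wedge (map y [length (vs @ [v])..<n]))"
    by (simp add: nth_append)
  finally show ?case by simp
qed

section \<open>Orthonormal bases\<close>

lemma orthonormal_basis_inner:
  fixes e :: "nat \<Rightarrow> 'a::euclidean_space"
  assumes "orthonormal_basis e" "i < DIM('a)" "j < DIM('a)"
  shows "e i \<bullet> e j = (if i = j then 1 else 0)"
  using assms by (simp add: orthonormal_basis_def)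

lemma orthonormal_basis_expand:
  fixes e :: "nat \<Rightarrow> 'a::euclidean_space"
  assumes e: "orthonormal_basis e"
  shows "v = (\<Sum>i<DIM('a). (e i \<bullet> v) *\<^sub>R e i)"
proof -
  let ?B = "e ` {..<DIM('a)}"
  note inn = orthonormal_basis_inner[OF e]
  have inj: "inj_on e {..<DIM('a)}"
  proof (rule inj_onI)
    fix i j assume "i \<in> {..<DIM('a)}" "j \<in> {..<DIM('a)}" "e i = e j"
    then show "i = j" using inn[of i j] inn[of i i] by (auto split: if_splits)
  qed
  have "pairwise orthogonal ?B"
    by (auto simp: pairwise_def orthogonal_def inn)
  moreover have "0 \<notin> ?B" using inn by fastforce
  ultimately have "independent ?B" by (rule pairwise_orthogonal_independent)
  then have span: "UNIV \<subseteq> span ?B"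
    by (intro card_ge_dim_independent) (auto simp: card_image[OF inj])
  define w where "w = v - (\<Sum>i<DIM('a). (e i \<bullet> v) *\<^sub>R e i)"
  have "w \<bullet> e j = 0" if "j < DIM('a)" for j
  proof -
    have "(\<Sum>i<DIM('a). (e i \<bullet> v) * (e i \<bullet> e j)) = (\<Sum>i<DIM('a). if i = j then e i \<bullet> v else 0)"
      by (rule sum.cong) (use that in \<open>auto simp: inn\<close>)
    then show ?thesis
      using that by (simp add: w_def inner_diff_left inner_sum_left inner_commute[of v])
  qed
  then have "orthogonal w b" if "b \<in> ?B" for b using that by (auto simp: orthogonal_def)
  then have "orthogonal w w" using span by (intro orthogonal_to_span[of w ?B]) auto
  then show ?thesis by (simp add: w_def orthogonal_self)
qed

text \<open>The tuples of length \<open>p\<close> with entries below \<open>n\<close>.\<close>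

definition index_lists :: "nat \<Rightarrow> nat \<Rightarrow> nat list set" where
  "index_lists n p = {is. length is = p \<and> set is \<subseteq> {..<n}}"

lemma index_lists_0 [simp]: "index_lists n 0 = {[]}"
  by (auto simp: index_lists_def)

lemma sum_index_lists_Suc:
  "(\<Sum>is\<in>index_lists n (Suc p). F is) = (\<Sum>i<n. \<Sum>is\<in>index_lists n p. F (i # is))"
proof -
  have "(\<Sum>i<n. \<Sum>is\<in>index_lists n p. F (i # is)) = (\<Sum>(i, is)\<in>{..<n} \<times> index_lists n p. F (i # is))"
    by (rule sum.cartesian_product)
  also have "\<dots> = (\<Sum>is\<in>index_lists n (Suc p). F is)"
    by (rule sum.reindex_bij_witness[where i = "\<lambda>is. (hd is, tl is)" and j = "\<lambda>(i, is). i # is"])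
      (auto simp: index_lists_def length_Suc_conv)
  finally show ?thesis by simp
qed

lemma wedge_expand:
  fixes e :: "nat \<Rightarrow> 'a::euclidean_space"
  assumes e: "orthonormal_basis e"
  shows "wedge vs = (\<Sum>is\<in>index_lists DIM('a) (length vs).
    (\<Prod>k<length vs. e (is ! k) \<bullet> vs ! k) *\<^sub>R wedge (map e is))"
proof (induction vs)
  case (Cons v vs)
  let ?L = "index_lists DIM('a) (length vs)"
  have "wedge (v # vs) = ext_vec (\<Sum>i<DIM('a). (e i \<bullet> v) *\<^sub>R e i) *
      (\<Sum>is\<in>?L. (\<Prod>k<length vs. e (is ! k) \<bullet> vs ! k) *\<^sub>R wedge (map e is))"
    using Cons orthonormal_basis_expand[OF e, of v] by simp
  also have "\<dots> = (\<Sum>i<DIM('a). \<Sum>is\<in>?L. ((e i \<bullet> v) * (\<Prod>k<length vs. e (is ! k) \<bullet> vs ! k)) *\<^sub>R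
      wedge (map e (i # is)))"
    unfolding ext_vec_linear sum_distrib_left sum_distrib_right
    by (subst sum.swap) (simp add: mult.commute)
  also have "\<dots> = (\<Sum>is\<in>index_lists DIM('a) (Suc (length vs)).
      (\<Prod>k<Suc (length vs). e (is ! k) \<bullet> (v # vs) ! k) *\<^sub>R wedge (map e is))"
    unfolding sum_index_lists_Suc prod.lessThan_Suc_shift by simp
  finally show ?case by simp
qed simp

section \<open>Products of double forms\<close>

lemma sum_swap_pairs:
  "(\<Sum>i\<in>A. \<Sum>j\<in>B. \<Sum>k\<in>C. \<Sum>l\<in>D. t i j k l) = (\<Sum>k\<in>C. \<Sum>l\<in>D. \<Sum>i\<in>A. \<Sum>j\<in>B. t i j k l)"
proof -
  have "(\<Sum>i\<in>A. \<Sum>j\<in>B. \<Sum>k\<in>C. \<Sum>l\<in>D. t i j k l) = (\<Sum>i\<in>A. \<Sum>k\<in>C. \<Sum>j\<in>B. \<Sum>l\<in>D. t i j k l)"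
    by (rule sum.cong[OF refl], rule sum.swap)
  also have "\<dots> = (\<Sum>k\<in>C. \<Sum>i\<in>A. \<Sum>j\<in>B. \<Sum>l\<in>D. t i j k l)"
    by (rule sum.swap)
  also have "\<dots> = (\<Sum>k\<in>C. \<Sum>i\<in>A. \<Sum>l\<in>D. \<Sum>j\<in>B. t i j k l)"
    by (rule sum.cong[OF refl], rule sum.cong[OF refl], rule sum.swap)
  also have "\<dots> = (\<Sum>k\<in>C. \<Sum>l\<in>D. \<Sum>i\<in>A. \<Sum>j\<in>B. t i j k l)"
    by (rule sum.cong[OF refl], rule sum.swap)
  finally show ?thesis .
qed

lemma bilinear_sum_scaleR:
  fixes h :: "'b::real_vector \<Rightarrow> 'c::real_vector \<Rightarrow> real"
  assumes h: "bilinear h"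
  shows "h (\<Sum>i\<in>A. a i *\<^sub>R f i) (\<Sum>j\<in>B. b j *\<^sub>R g j) = (\<Sum>i\<in>A. \<Sum>j\<in>B. a i * b j * h (f i) (g j))"
proof -
  have l: "linear (\<lambda>x. h x y)" and r: "linear (h x)" for x y
    using h by (auto simp: bilinear_def)
  show ?thesis
    unfolding linear_sum[OF l] linear_scale[OF l] linear_sum[OF r] linear_scale[OF r]
    by (simp add: sum_distrib_left mult_ac) (rule sum.swap)
qed

lemma ext_grade_in_span_wedge: "ext_grade p \<phi> \<in> span {wedge vs | vs. length vs = p}"
  for \<phi> :: "'a::euclidean_space ext"
proof (induction \<phi> arbitrary: p rule: ext_induct)
  case one
  have "(1 :: 'a ext) \<in> span {wedge vs | vs. length vs = 0}" by (rule span_base) simp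
  then show ?case by (auto simp: ext_grade_one span_zero)
next
  case (vec v \<phi>)
  show ?case
  proof (cases p)
    case 0
    then show ?thesis by (simp add: ext_grade_vec_mult_0 span_zero)
  next
    case (Suc q)
    have "linear (\<lambda>\<psi>. ext_vec v * \<psi>)" by (rule linearI) (simp_all add: distrib_left)
    then have "ext_vec v * ext_grade q \<phi> \<in> span ((\<lambda>\<psi>. ext_vec v * \<psi>) ` {wedge vs | vs. length vs = q})"
      using vec[of q] by (auto simp: linear_span_image)
    moreover have "(\<lambda>\<psi>. ext_vec v * \<psi>) ` {wedge vs | vs. length vs = q} \<subseteq> {wedge vs | vs. length vs = p}"
    proof clarify
      fix vs :: "'a list" assume "q = length vs"
      then show "\<exists>vs'. ext_vec v * wedge vs = wedge vs' \<and> length vs' = p"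
        using Suc by (intro exI[of _ "v # vs"]) simp
    qed
    ultimately show ?thesis
      unfolding Suc ext_grade_vec_mult_Suc using span_mono unfolding Suc by blast
  qed
qed (simp_all add: ext_grade_linear span_add span_scale)

lemma double_form_eqI:
  fixes \<eta> \<theta> :: "'a::euclidean_space dform"
  assumes \<eta>: "double_form p q \<eta>" and \<theta>: "double_form p q \<theta>"
    and eq: "\<And>x y :: nat \<Rightarrow> 'a. \<eta> (wedge (map x [0..<p])) (wedge (map y [0..<q])) =
      \<theta> (wedge (map x [0..<p])) (wedge (map y [0..<q]))"
  shows "\<eta> = \<theta>"
proof (intro HOL.ext)
  fix \<phi> \<psi> :: "'a ext"
  have W: "wedge vs = wedge (map ((!) vs) [0..<length vs])" for vs :: "'a list"
    by (simp add: map_nth)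
  have eq': "\<eta> a b = \<theta> a b" if ab: "a \<in> {wedge vs | vs. length vs = p}" "b \<in> {wedge vs | vs. length vs = q}"
    for a b
  proof -
    from ab obtain vs ws where "a = wedge vs" "length vs = p" "b = wedge ws" "length ws = q" by blast
    then show ?thesis using eq[of "(!) vs" "(!) ws"] W[of vs] W[of ws] by simp
  qed
  have bil: "bilinear \<eta>" "bilinear \<theta>" using \<eta> \<theta> by (auto simp: double_form_def)
  have "{ext_grade p \<phi>} \<subseteq> span {wedge vs | vs. length vs = p}"
    and "{ext_grade q \<psi>} \<subseteq> span {wedge vs | vs. length vs = q}"
    by (simp_all add: ext_grade_in_span_wedge)
  note bilinear_eq[OF bil this singletonI singletonI eq']
  then show "\<eta> \<phi> \<psi> = \<theta> \<phi> \<psi>" using \<eta> \<theta> unfolding double_form_def by metis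
qed

text \<open>The product of a \<open>(p, q)\<close>-double form \<open>\<omega>\<^sub>1\<close> with \<open>\<omega>\<^sub>2\<close> in an orthonormal basis. Tuples are not
  required to increase, which is compensated by the factorials.\<close>

definition dform_prod_coord ::
    "(nat \<Rightarrow> 'a::euclidean_space) \<Rightarrow> nat \<Rightarrow> nat \<Rightarrow> 'a dform \<Rightarrow> 'a dform \<Rightarrow> 'a dform" where
  "dform_prod_coord e p q \<omega>\<^sub>1 \<omega>\<^sub>2 \<phi> \<psi> = 1 / (fact p * fact q) *
    (\<Sum>I\<in>index_lists DIM('a) p. \<Sum>K\<in>index_lists DIM('a) q.
      \<omega>\<^sub>1 (wedge (map e I)) (wedge (map e K)) * \<omega>\<^sub>2 (interiors (map e I) \<phi>) (interiors (map e K) \<psi>))"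

lemma double_form_prod_coord:
  assumes "double_form r s \<omega>\<^sub>2"
  shows "double_form (p + r) (q + s) (dform_prod_coord e p q \<omega>\<^sub>1 \<omega>\<^sub>2)"
  unfolding double_form_def
proof (intro conjI allI)
  have bil: "bilinear \<omega>\<^sub>2" and gr: "\<And>\<phi> \<psi>. \<omega>\<^sub>2 \<phi> \<psi> = \<omega>\<^sub>2 (ext_grade r \<phi>) (ext_grade s \<psi>)"
    using assms by (auto simp: double_form_def)
  show "bilinear (dform_prod_coord e p q \<omega>\<^sub>1 \<omega>\<^sub>2)"
    unfolding bilinear_def dform_prod_coord_def
    by (intro conjI allI linearI)
      (simp_all add: linear_add[OF linear_interiors] linear_scale[OF linear_interiors]
        bilinear_ladd[OF bil] bilinear_radd[OF bil] bilinear_lmul[OF bil] bilinear_rmul[OF bil]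
        distrib_left sum.distrib sum_distrib_left mult_ac)
  fix \<phi> \<psi>
  show "dform_prod_coord e p q \<omega>\<^sub>1 \<omega>\<^sub>2 \<phi> \<psi> =
      dform_prod_coord e p q \<omega>\<^sub>1 \<omega>\<^sub>2 (ext_grade (p + r) \<phi>) (ext_grade (q + s) \<psi>)"
    unfolding dform_prod_coord_def
  proof (intro arg_cong2[where f = "(*)"] refl sum.cong)
    fix I K assume "I \<in> index_lists DIM('a) p" "K \<in> index_lists DIM('a) q"
    then have "length I = p" "length K = q" by (auto simp: index_lists_def)
    then show "\<omega>\<^sub>2 (interiors (map e I) \<phi>) (interiors (map e K) \<psi>) =
      \<omega>\<^sub>2 (interiors (map e I) (ext_grade (p + r) \<phi>)) (interiors (map e K) (ext_grade (q + s) \<psi>))"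
      by (subst gr) (simp add: ext_grade_interiors)
  qed
qed

lemma dform_prod_coord_wedge:
  fixes \<omega>\<^sub>1 \<omega>\<^sub>2 :: "'a::euclidean_space dform"
  assumes e: "orthonormal_basis e" and \<omega>\<^sub>1: "bilinear \<omega>\<^sub>1" and \<omega>\<^sub>2: "bilinear \<omega>\<^sub>2"
  shows "dform_prod_coord e p q \<omega>\<^sub>1 \<omega>\<^sub>2 (wedge (map x [0..<p + r])) (wedge (map y [0..<q + s])) =
      1 / (fact p * fact r * fact s * fact q) *
      (\<Sum>\<sigma> | \<sigma> permutes {..<p + r}. \<Sum>\<rho> | \<rho> permutes {..<q + s}.
        of_int (sign \<sigma>) * of_int (sign \<rho>) *
        \<omega>\<^sub>1 (wedge (map (x \<circ> \<sigma>) [0..<p])) (wedge (map (y \<circ> \<rho>) [0..<q])) *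
        \<omega>\<^sub>2 (wedge (map (x \<circ> \<sigma>) [p..<p + r])) (wedge (map (y \<circ> \<rho>) [q..<q + s])))"
proof -
  let ?N = "DIM('a)"
  define a where "a I \<sigma> = (\<Prod>i<p. e (I ! i) \<bullet> x (\<sigma> i))" for I and \<sigma> :: "nat \<Rightarrow> nat"
  define b where "b K \<rho> = (\<Prod>i<q. e (K ! i) \<bullet> y (\<rho> i))" for K and \<rho> :: "nat \<Rightarrow> nat"
  define W where "W = (\<lambda>(\<sigma>, \<rho>). of_int (sign \<sigma>) * of_int (sign \<rho>) *
      \<omega>\<^sub>2 (wedge (map (x \<circ> \<sigma>) [p..<p + r])) (wedge (map (y \<circ> \<rho>) [q..<q + s])))"
  define X where "X = (\<lambda>(I, K). \<omega>\<^sub>1 (wedge (map e I)) (wedge (map e K)))"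
  define ab where "ab = (\<lambda>(I, K) (\<sigma>, \<rho>). a I \<sigma> * b K \<rho>)"
  have int: "interiors (map e I) (wedge (map z [0..<m + t])) = (\<Sum>\<sigma> | \<sigma> permutes {..<m + t}.
      (1 / fact t * of_int (sign \<sigma>) * (\<Prod>i<m. e (I ! i) \<bullet> z (\<sigma> i))) *\<^sub>R wedge (map (z \<circ> \<sigma>) [m..<m + t]))"
    if "I \<in> index_lists ?N m" for I m t z
  proof -
    have I: "length I = m" using that by (simp add: index_lists_def)
    have "(\<Prod>i<m. map e I ! i \<bullet> (z \<circ> \<sigma>) i) = (\<Prod>i<m. e (I ! i) \<bullet> z (\<sigma> i))" for \<sigma>
      by (rule prod.cong) (simp_all add: I)
    then show ?thesis
      using interiors_wedge[of "map e I" "m + t" z]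
      by (simp only: length_map I le_add1 add_diff_cancel_left' alternation_def)
        (simp add: scaleR_sum_right mult_ac)
  qed
  have exp: "wedge (map z [0..<m]) = (\<Sum>I\<in>index_lists ?N m. (\<Prod>i<m. e (I ! i) \<bullet> z i) *\<^sub>R wedge (map e I))"
    for m z
  proof -
    have "(\<Prod>k<m. e (I ! k) \<bullet> map z [0..<m] ! k) = (\<Prod>i<m. e (I ! i) \<bullet> z i)" for I
      by (rule prod.cong) simp_all
    then show ?thesis using wedge_expand[OF e, of "map z [0..<m]"] by simp
  qed
  have "dform_prod_coord e p q \<omega>\<^sub>1 \<omega>\<^sub>2 (wedge (map x [0..<p + r])) (wedge (map y [0..<q + s])) =
      1 / (fact p * fact q) * (\<Sum>I\<in>index_lists ?N p. \<Sum>K\<in>index_lists ?N q. X (I, K) *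
        (\<Sum>\<sigma> | \<sigma> permutes {..<p + r}. \<Sum>\<rho> | \<rho> permutes {..<q + s}.
          1 / (fact r * fact s) * (ab (I, K) (\<sigma>, \<rho>) * W (\<sigma>, \<rho>))))"
    unfolding dform_prod_coord_def
  proof (intro arg_cong2[where f = "(*)"] refl sum.cong)
    fix I K assume I: "I \<in> index_lists ?N p" and K: "K \<in> index_lists ?N q"
    show "\<omega>\<^sub>1 (wedge (map e I)) (wedge (map e K)) = X (I, K)" by (simp add: X_def)
    show "\<omega>\<^sub>2 (interiors (map e I) (wedge (map x [0..<p + r]))) (interiors (map e K) (wedge (map y [0..<q + s]))) =
        (\<Sum>\<sigma> | \<sigma> permutes {..<p + r}. \<Sum>\<rho> | \<rho> permutes {..<q + s}.
          1 / (fact r * fact s) * (ab (I, K) (\<sigma>, \<rho>) * W (\<sigma>, \<rho>)))"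
      unfolding int[OF I] int[OF K] bilinear_sum_scaleR[OF \<omega>\<^sub>2]
      by (intro sum.cong refl) (simp add: ab_def W_def a_def b_def)
  qed
  also have "\<dots> = 1 / (fact p * fact r * fact s * fact q) *
      (\<Sum>I\<in>index_lists ?N p. \<Sum>K\<in>index_lists ?N q.
        \<Sum>\<sigma> | \<sigma> permutes {..<p + r}. \<Sum>\<rho> | \<rho> permutes {..<q + s}.
          X (I, K) * ab (I, K) (\<sigma>, \<rho>) * W (\<sigma>, \<rho>))"
    by (simp add: sum_distrib_left mult_ac)
  also have "(\<Sum>I\<in>index_lists ?N p. \<Sum>K\<in>index_lists ?N q.
        \<Sum>\<sigma> | \<sigma> permutes {..<p + r}. \<Sum>\<rho> | \<rho> permutes {..<q + s}.
          X (I, K) * ab (I, K) (\<sigma>, \<rho>) * W (\<sigma>, \<rho>)) =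
      (\<Sum>\<sigma> | \<sigma> permutes {..<p + r}. \<Sum>\<rho> | \<rho> permutes {..<q + s}.
        \<Sum>I\<in>index_lists ?N p. \<Sum>K\<in>index_lists ?N q.
          X (I, K) * ab (I, K) (\<sigma>, \<rho>) * W (\<sigma>, \<rho>))"
    by (rule sum_swap_pairs)
  also have "\<dots> = (\<Sum>\<sigma> | \<sigma> permutes {..<p + r}. \<Sum>\<rho> | \<rho> permutes {..<q + s}.
        of_int (sign \<sigma>) * of_int (sign \<rho>) *
        \<omega>\<^sub>1 (wedge (map (x \<circ> \<sigma>) [0..<p])) (wedge (map (y \<circ> \<rho>) [0..<q])) *
        \<omega>\<^sub>2 (wedge (map (x \<circ> \<sigma>) [p..<p + r])) (wedge (map (y \<circ> \<rho>) [q..<q + s])))"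
    unfolding exp bilinear_sum_scaleR[OF \<omega>\<^sub>1]
    by (intro sum.cong refl)
      (simp add: X_def ab_def W_def a_def b_def sum_distrib_left sum_distrib_right mult_ac)
  finally show ?thesis .
qed

text \<open>The right-hand side has the prescribed values on decomposable elements, and these determine a
  double form.\<close>

lemma dform_prod_eq_coord:
  fixes \<omega>\<^sub>1 \<omega>\<^sub>2 :: "'a::euclidean_space dform"
  assumes e: "orthonormal_basis e" and \<omega>\<^sub>1: "bilinear \<omega>\<^sub>1" and \<omega>\<^sub>2: "double_form r s \<omega>\<^sub>2"
  shows "dform_prod p q r s \<omega>\<^sub>1 \<omega>\<^sub>2 = dform_prod_coord e p q \<omega>\<^sub>1 \<omega>\<^sub>2"
  unfolding dform_prod_def
proof (rule the_equality)
  have "bilinear \<omega>\<^sub>2" using \<omega>\<^sub>2 by (simp add: double_form_def)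
  note coord = dform_prod_coord_wedge[OF e \<omega>\<^sub>1 this]
  show "double_form (p + r) (q + s) (dform_prod_coord e p q \<omega>\<^sub>1 \<omega>\<^sub>2) \<and>
    (\<forall>x y. dform_prod_coord e p q \<omega>\<^sub>1 \<omega>\<^sub>2 (wedge (map x [0..<p + r])) (wedge (map y [0..<q + s])) =
      1 / (fact p * fact r * fact s * fact q) *
      (\<Sum>\<sigma> | \<sigma> permutes {..<p + r}. \<Sum>\<rho> | \<rho> permutes {..<q + s}.
        of_int (sign \<sigma>) * of_int (sign \<rho>) *
        \<omega>\<^sub>1 (wedge (map (x \<circ> \<sigma>) [0..<p])) (wedge (map (y \<circ> \<rho>) [0..<q])) *
        \<omega>\<^sub>2 (wedge (map (x \<circ> \<sigma>) [p..<p + r])) (wedge (map (y \<circ> \<rho>) [q..<q + s]))))"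
    by (intro conjI allI double_form_prod_coord \<omega>\<^sub>2 coord)
  fix \<eta> :: "'a dform"
  assume \<eta>: "double_form (p + r) (q + s) \<eta> \<and>
    (\<forall>x y. \<eta> (wedge (map x [0..<p + r])) (wedge (map y [0..<q + s])) =
      1 / (fact p * fact r * fact s * fact q) *
      (\<Sum>\<sigma> | \<sigma> permutes {..<p + r}. \<Sum>\<rho> | \<rho> permutes {..<q + s}.
        of_int (sign \<sigma>) * of_int (sign \<rho>) *
        \<omega>\<^sub>1 (wedge (map (x \<circ> \<sigma>) [0..<p])) (wedge (map (y \<circ> \<rho>) [0..<q])) *
        \<omega>\<^sub>2 (wedge (map (x \<circ> \<sigma>) [p..<p + r])) (wedge (map (y \<circ> \<rho>) [q..<q + s]))))"
  show "\<eta> = dform_prod_coord e p q \<omega>\<^sub>1 \<omega>\<^sub>2"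
    by (rule double_form_eqI[OF conjunct1[OF \<eta>] double_form_prod_coord[OF \<omega>\<^sub>2]])
      (simp only: coord \<eta>[THEN conjunct2, rule_format])
qed

section \<open>Powers of the metric\<close>

lemma orthonormal_basis_ref_basis: "orthonormal_basis (ref_basis :: nat \<Rightarrow> 'a::euclidean_space)"
  by (simp add: orthonormal_basis_def inner_ref_basis)

lemma sum_orthonormal_basis_linear:
  fixes e :: "nat \<Rightarrow> 'a::euclidean_space"
  assumes "orthonormal_basis e" "linear h"
  shows "(\<Sum>i<DIM('a). (e i \<bullet> v) *\<^sub>R h (e i)) = h v"
proof -
  have "h v = h (\<Sum>i<DIM('a). (e i \<bullet> v) *\<^sub>R e i)"
    using orthonormal_basis_expand[OF assms(1), of v] by simp
  then show ?thesis
    by (simp add: linear_sum[OF assms(2)] linear_scale[OF assms(2)])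
qed

text \<open>The operator \<open>\<Sum>\<^sub>i \<epsilon>\<^sub>i \<iota>\<^sub>i\<close> is the degree: its commutator with \<open>\<epsilon>\<^sub>v\<close> is \<open>\<epsilon>\<^sub>v\<close>.\<close>

lemma ext_grade_sum_vec_interior:
  fixes e :: "nat \<Rightarrow> 'a::euclidean_space"
  assumes e: "orthonormal_basis e"
  shows "ext_grade k (\<Sum>i<DIM('a). ext_vec (e i) * interior (e i) \<psi>) = real k *\<^sub>R ext_grade k \<psi>"
proof (induction \<psi> arbitrary: k rule: ext_induct)
  case (add \<phi> \<psi>)
  then show ?case
    by (simp add: interior_linear ext_grade_linear distrib_left sum.distrib scaleR_right_distrib)
next
  case (scale r \<phi>)
  have "(\<Sum>i<DIM('a). ext_vec (e i) * interior (e i) (r *\<^sub>R \<phi>)) =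
      r *\<^sub>R (\<Sum>i<DIM('a). ext_vec (e i) * interior (e i) \<phi>)"
    by (simp add: interior_linear scaleR_sum_right)
  then show ?case by (simp only: scale linear_scale[OF linear_ext_grade]) simp
next
  case one
  show ?case by (simp add: ext_grade_one ext_grade_linear)
next
  case (vec v \<phi>)
  have "linear (\<lambda>u. ext_vec u * \<phi>)"
    by (rule linearI) (simp_all add: ext_vec_linear distrib_right)
  from sum_orthonormal_basis_linear[OF e this, of v]
  have "(\<Sum>i<DIM('a). (e i \<bullet> v) *\<^sub>R (ext_vec (e i) * \<phi>)) = ext_vec v * \<phi>" .
  then have comm: "(\<Sum>i<DIM('a). ext_vec (e i) * interior (e i) (ext_vec v * \<phi>)) =
      ext_vec v * \<phi> + ext_vec v * (\<Sum>i<DIM('a). ext_vec (e i) * interior (e i) \<phi>)"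
    by (simp add: interior_vec_mult right_diff_distrib sum_distrib_left
        ext_vec_anticommute_left[of _ v] sum.distrib)
  show ?case
  proof (cases k)
    case 0
    then show ?thesis
      unfolding comm by (simp add: ext_grade_linear ext_grade_vec_mult_0)
  next
    case (Suc m)
    then show ?thesis
      unfolding comm using vec[of m]
      by (simp add: ext_grade_linear(1) ext_grade_vec_mult_Suc scaleR_left_distrib)
  qed
qed

lemma sum_inner_interior:
  fixes e :: "nat \<Rightarrow> 'a::euclidean_space"
  assumes e: "orthonormal_basis e"
  shows "(\<Sum>i<DIM('a). ext_grade k (interior (e i) \<phi>) \<bullet> ext_grade k (interior (e i) \<psi>)) =
    real (Suc k) * (ext_grade (Suc k) \<phi> \<bullet> ext_grade (Suc k) \<psi>)"
proof -
  let ?\<psi> = "ext_grade (Suc k) \<psi>"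
  have "(\<Sum>i<DIM('a). ext_grade k (interior (e i) \<phi>) \<bullet> ext_grade k (interior (e i) \<psi>)) =
      (\<Sum>i<DIM('a). ext_grade (Suc k) \<phi> \<bullet> (ext_vec (e i) * interior (e i) ?\<psi>))"
    by (simp add: ext_grade_interior interior_adjoint')
  also have "\<dots> = ext_grade (Suc k) \<phi> \<bullet> ext_grade (Suc k) (\<Sum>i<DIM('a). ext_vec (e i) * interior (e i) ?\<psi>)"
    by (simp add: inner_sum_right[symmetric] ext_grade_adjoint[symmetric] ext_grade_grade)
  also have "\<dots> = real (Suc k) * (ext_grade (Suc k) \<phi> \<bullet> ?\<psi>)"
    by (simp only: ext_grade_sum_vec_interior[OF e] ext_grade_grade inner_scaleR_right simp_thms if_True)
  finally show ?thesis .
qed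

text \<open>The inner product of \<open>\<Lambda>\<^sup>kV\<close> as a \<open>(k, k)\<close>-double form.\<close>

definition dform_inner :: "nat \<Rightarrow> 'a::euclidean_space dform" where
  "dform_inner k \<phi> \<psi> = ext_grade k \<phi> \<bullet> ext_grade k \<psi>"

lemma double_form_inner: "double_form k k (dform_inner k)"
  unfolding double_form_def bilinear_def dform_inner_def
  by (intro conjI allI linearI)
    (simp_all add: ext_grade_linear ext_grade_grade inner_add_left inner_add_right)

lemma double_form_scale: "double_form p q \<eta> \<Longrightarrow> double_form p q (\<lambda>\<phi> \<psi>. c * \<eta> \<phi> \<psi>)"
  unfolding double_form_def bilinear_def linear_iff by (auto simp: distrib_left)

lemma bilinear_double_form: "double_form p q \<eta> \<Longrightarrow> bilinear \<eta>"
  by (simp add: double_form_def)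

lemma inner_ext_vec: "ext_vec v \<bullet> ext_vec w = v \<bullet> w" for v w :: "'a::euclidean_space"
proof -
  have "(1 :: 'a ext) \<bullet> 1 = 1"
    by (simp add: inner_ext_def one_ext.rep_eq if_distrib[of "\<lambda>x. x * _"] cong: if_cong)
  then show ?thesis
    using interior_adjoint[of v 1 "ext_vec w"] interior_vec_mult[of v w 1] by simp
qed

lemma dform_metric_eq_inner: "dform_metric = dform_inner 1"
  by (intro HOL.ext) (simp add: dform_metric_def dform_inner_def)

lemma dform_metric_vec: "dform_metric (ext_vec v) (ext_vec w) = v \<bullet> w"
  using ext_grade_wedge[of 1 "[v]"] ext_grade_wedge[of 1 "[w]"]
  by (simp add: dform_metric_def inner_ext_vec)

lemma dform_prod_coord_1:
  fixes e :: "nat \<Rightarrow> 'a::euclidean_space"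
  shows "dform_prod_coord e 1 1 \<omega>\<^sub>1 \<omega>\<^sub>2 \<phi> \<psi> = (\<Sum>i<DIM('a). \<Sum>k<DIM('a).
    \<omega>\<^sub>1 (ext_vec (e i)) (ext_vec (e k)) * \<omega>\<^sub>2 (interior (e i) \<phi>) (interior (e k) \<psi>))"
  by (simp add: dform_prod_coord_def sum_index_lists_Suc)

lemma dform_prod_coord_2:
  fixes e :: "nat \<Rightarrow> 'a::euclidean_space"
  shows "dform_prod_coord e 2 2 \<omega>\<^sub>1 \<omega>\<^sub>2 \<phi> \<psi> = 1 / 4 *
    (\<Sum>i<DIM('a). \<Sum>j<DIM('a). \<Sum>k<DIM('a). \<Sum>l<DIM('a).
      \<omega>\<^sub>1 (wedge [e i, e j]) (wedge [e k, e l]) *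
      \<omega>\<^sub>2 (interior (e j) (interior (e i) \<phi>)) (interior (e l) (interior (e k) \<psi>)))"
  by (simp add: dform_prod_coord_def numeral_2_eq_2 sum_index_lists_Suc)

lemma dform_prod_metric:
  fixes e :: "nat \<Rightarrow> 'a::euclidean_space"
  assumes e: "orthonormal_basis e" and \<eta>: "double_form r s \<eta>"
  shows "dform_prod 1 1 r s dform_metric \<eta> \<phi> \<psi> = (\<Sum>i<DIM('a). \<eta> (interior (e i) \<phi>) (interior (e i) \<psi>))"
proof -
  have "bilinear (dform_metric :: 'a dform)"
    unfolding dform_metric_eq_inner by (rule bilinear_double_form[OF double_form_inner])
  from dform_prod_eq_coord[OF e this \<eta>]
  have "dform_prod 1 1 r s dform_metric \<eta> \<phi> \<psi> = (\<Sum>i<DIM('a). \<Sum>k<DIM('a).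
      (e i \<bullet> e k) * \<eta> (interior (e i) \<phi>) (interior (e k) \<psi>))"
    by (simp only: dform_prod_coord_1 dform_metric_vec)
  also have "\<dots> = (\<Sum>i<DIM('a). \<Sum>k<DIM('a). if k = i then \<eta> (interior (e i) \<phi>) (interior (e k) \<psi>) else 0)"
    by (intro sum.cong refl) (simp add: orthonormal_basis_inner[OF e])
  finally show ?thesis by simp
qed

lemma dform_metric_pow_eq: "dform_metric_pow k = (\<lambda>\<phi> \<psi>. fact k * dform_inner k \<phi> \<psi>)"
proof (induction k)
  case 0
  show ?case by (intro HOL.ext) (simp add: dform_one_def dform_inner_def)
next
  case (Suc k)
  have "dform_metric_pow (Suc k) \<phi> \<psi> = fact k * (\<Sum>i<DIM('a).
      dform_inner k (interior (ref_basis i) \<phi>) (interior (ref_basis i) \<psi>))" for \<phi> \<psi> :: "'a ext"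
    unfolding dform_metric_pow.simps Suc
      dform_prod_metric[OF orthonormal_basis_ref_basis double_form_scale[OF double_form_inner]]
    by (simp add: sum_distrib_left)
  then show ?case
    by (intro HOL.ext)
      (simp add: dform_inner_def sum_inner_interior[OF orthonormal_basis_ref_basis] del: of_nat_Suc)
qed

section \<open>Contraction\<close>

lemma double_form_contraction:
  assumes "double_form (Suc p) (Suc q) \<omega>"
  shows "double_form p q (contraction e \<omega>)"
proof -
  have bil: "bilinear \<omega>" and gr: "\<And>\<phi> \<psi>. \<omega> \<phi> \<psi> = \<omega> (ext_grade (Suc p) \<phi>) (ext_grade (Suc q) \<psi>)"
    using assms by (auto simp: double_form_def)
  show ?thesis
    unfolding double_form_def
  proof (intro conjI allI)
    show "bilinear (contraction e \<omega>)"
      unfolding bilinear_def contraction_def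
      by (intro conjI allI linearI)
        (simp_all add: distrib_left bilinear_ladd[OF bil] bilinear_radd[OF bil]
          bilinear_lmul[OF bil] bilinear_rmul[OF bil] sum.distrib sum_distrib_left)
    fix \<phi> \<psi>
    show "contraction e \<omega> \<phi> \<psi> = contraction e \<omega> (ext_grade p \<phi>) (ext_grade q \<psi>)"
      unfolding contraction_def
      by (rule sum.cong[OF refl], subst gr) (simp add: ext_grade_vec_mult_Suc)
  qed
qed

lemma sum_bilinear_orthonormal_basis:
  fixes e f :: "nat \<Rightarrow> 'a::euclidean_space" and h :: "'a \<Rightarrow> 'a \<Rightarrow> real"
  assumes e: "orthonormal_basis e" and f: "orthonormal_basis f" and h: "bilinear h"
  shows "(\<Sum>j<DIM('a). h (f j) (f j)) = (\<Sum>i<DIM('a). h (e i) (e i))"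
proof -
  have inn: "(\<Sum>j<DIM('a). (v \<bullet> f j) * (w \<bullet> f j)) = v \<bullet> w" for v w
  proof -
    have "linear (\<lambda>u. v \<bullet> u)" by (rule linearI) (simp_all add: inner_add_right)
    from sum_orthonormal_basis_linear[OF f this, of w] show ?thesis
      by (simp add: inner_commute[of w] mult.commute)
  qed
  have "(\<Sum>j<DIM('a). h (f j) (f j)) = (\<Sum>j<DIM('a). \<Sum>i<DIM('a). \<Sum>k<DIM('a).
      (e i \<bullet> f j) * (e k \<bullet> f j) * h (e i) (e k))"
    unfolding bilinear_sum_scaleR[OF h, symmetric] orthonormal_basis_expand[OF e, symmetric] ..
  also have "\<dots> = (\<Sum>i<DIM('a). \<Sum>j<DIM('a). \<Sum>k<DIM('a). (e i \<bullet> f j) * (e k \<bullet> f j) * h (e i) (e k))"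
    by (rule sum.swap)
  also have "\<dots> = (\<Sum>i<DIM('a). \<Sum>k<DIM('a). \<Sum>j<DIM('a). (e i \<bullet> f j) * (e k \<bullet> f j) * h (e i) (e k))"
    by (rule sum.cong[OF refl], rule sum.swap)
  also have "\<dots> = (\<Sum>i<DIM('a). \<Sum>k<DIM('a). if k = i then h (e i) (e k) else 0)"
    unfolding sum_distrib_right[symmetric] inn
    by (intro sum.cong refl) (simp add: orthonormal_basis_inner[OF e])
  finally show ?thesis by simp
qed

lemma contraction_orthonormal_basis:
  assumes e: "orthonormal_basis e" and f: "orthonormal_basis f" and \<omega>: "bilinear \<omega>"
  shows "contraction f \<omega> = contraction e \<omega>"
proof (intro HOL.ext)
  fix \<phi> \<psi>
  have "bilinear (\<lambda>v w. \<omega> (ext_vec v * \<phi>) (ext_vec w * \<psi>))"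
    unfolding bilinear_def
    by (intro conjI allI linearI)
      (simp_all add: ext_vec_linear distrib_right bilinear_ladd[OF \<omega>] bilinear_radd[OF \<omega>]
        bilinear_lmul[OF \<omega>] bilinear_rmul[OF \<omega>])
  from sum_bilinear_orthonormal_basis[OF e f this]
  show "contraction f \<omega> \<phi> \<psi> = contraction e \<omega> \<phi> \<psi>"
    by (simp add: contraction_def)
qed

section \<open>Antisymmetric coefficients\<close>

lemma sum_less_eq_half_sum:
  fixes G :: "nat \<Rightarrow> nat \<Rightarrow> real"
  assumes "\<And>i j. G j i = G i j" "\<And>i. G i i = 0"
  shows "(\<Sum>j<n. \<Sum>i<j. G i j) = 1 / 2 * (\<Sum>i<n. \<Sum>j<n. G i j)"
proof (induction n)
  case (Suc n)
  have "(\<Sum>j<n. G n j) = (\<Sum>i<n. G i n)" by (rule sum.cong[OF refl]) (rule assms(1))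
  then show ?case using Suc by (simp add: sum.distrib assms(2))
qed simp

text \<open>Against a tensor \<open>T\<close> that is antisymmetric in its first two and in its last two indices, each of the four terms of the antisymmetrization of \<open>A\<close>
  contributes the same sum.\<close>

lemma sum_antisymmetrize:
  fixes A T :: "nat \<Rightarrow> nat \<Rightarrow> nat \<Rightarrow> nat \<Rightarrow> real"
  assumes T1: "\<And>i j k l. T j i k l = - T i j k l" and T2: "\<And>i j k l. T i j l k = - T i j k l"
  shows "(\<Sum>i<n. \<Sum>j<n. \<Sum>k<n. \<Sum>l<n. (A i j k l - A j i k l - A i j l k + A j i l k) * T i j k l) =
    4 * (\<Sum>i<n. \<Sum>j<n. \<Sum>k<n. \<Sum>l<n. A i j k l * T i j k l)"
proof -
  let ?S = "\<lambda>F :: nat \<Rightarrow> nat \<Rightarrow> nat \<Rightarrow> nat \<Rightarrow> real. \<Sum>i<n. \<Sum>j<n. \<Sum>k<n. \<Sum>l<n. F i j k l"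
  have ij: "?S (\<lambda>i j k l. A j i k l * T i j k l) = - ?S (\<lambda>i j k l. A i j k l * T i j k l)" for A
  proof -
    have "?S (\<lambda>i j k l. A j i k l * T i j k l) = ?S (\<lambda>i j k l. A i j k l * T j i k l)"
      by (rule sum.swap)
    also have "\<dots> = - ?S (\<lambda>i j k l. A i j k l * T i j k l)"
    proof -
      have "A i j k l * T j i k l = - (A i j k l * T i j k l)" for i j k l
        by (simp only: T1[of i j k l] mult_minus_right)
      then show ?thesis by (simp only: sum_negf)
    qed
    finally show ?thesis .
  qed
  have kl: "?S (\<lambda>i j k l. A i j l k * T i j k l) = - ?S (\<lambda>i j k l. A i j k l * T i j k l)" for A
  proof -
    have "?S (\<lambda>i j k l. A i j l k * T i j k l) = ?S (\<lambda>i j k l. A i j k l * T i j l k)"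
      by (rule sum.cong[OF refl], rule sum.cong[OF refl], rule sum.swap)
    also have "\<dots> = - ?S (\<lambda>i j k l. A i j k l * T i j k l)"
    proof -
      have "A i j k l * T i j l k = - (A i j k l * T i j k l)" for i j k l
        by (simp only: T2[of i j k l] mult_minus_right)
      then show ?thesis by (simp only: sum_negf)
    qed
    finally show ?thesis .
  qed
  have "?S (\<lambda>i j k l. (A i j k l - A j i k l - A i j l k + A j i l k) * T i j k l) =
      ?S (\<lambda>i j k l. A i j k l * T i j k l) - ?S (\<lambda>i j k l. A j i k l * T i j k l)
      - ?S (\<lambda>i j k l. A i j l k * T i j k l) + ?S (\<lambda>i j k l. A j i l k * T i j k l)"
    by (simp add: algebra_simps sum.distrib sum_subtractf)
  also have "?S (\<lambda>i j k l. A j i l k * T i j k l) = - ?S (\<lambda>i j k l. A i j l k * T i j k l)"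
    by (rule ij[of "\<lambda>i j k l. A i j l k"])
  finally show ?thesis by (simp only: ij[of A] kl[of A])
qed

section \<open>The Weitzenboeck transformation\<close>

lemma wedge_pair_swap: "wedge [v, w] = - wedge [w, v]"
  using wedge_swap[of "[]" v "[]" w "[]"] by simp

lemma interior_wedge_pair: "interior u (wedge [v, w]) = (u \<bullet> v) *\<^sub>R ext_vec w - (u \<bullet> w) *\<^sub>R ext_vec v"
  by (simp add: interior_vec_mult interior_vec_mult[of u w 1, simplified])

lemma inner_vec_mult_interior:
  "(ext_vec b * interior a \<phi>) \<bullet> (ext_vec d * interior c \<psi>) =
    (b \<bullet> d) * (interior a \<phi> \<bullet> interior c \<psi>) - interior d (interior a \<phi>) \<bullet> interior b (interior c \<psi>)"
  by (simp only: interior_adjoint')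
    (simp add: interior_vec_mult inner_diff_left interior_adjoint inner_commute[of d b])

text \<open>The two sums over increasing pairs contribute a factor \<open>1/4\<close>, the two factors \<open>2\<close> of
  \<open>clifford_ad_vec_vec\<close> a factor \<open>4\<close>, and the antisymmetrization another \<open>4\<close>; this cancels the \<open>1/4\<close> of
  the definition.\<close>

lemma weitzenboeck_eq_sum:
  fixes e :: "nat \<Rightarrow> 'a::euclidean_space"
  assumes \<omega>: "bilinear \<omega>"
  shows "weitzenboeck e p \<omega> \<psi>\<^sub>1 \<psi>\<^sub>2 = (\<Sum>i<DIM('a). \<Sum>j<DIM('a). \<Sum>k<DIM('a). \<Sum>l<DIM('a).
    ((ext_vec (e j) * interior (e i) (ext_grade p \<psi>\<^sub>1)) \<bullet> (ext_vec (e l) * interior (e k) (ext_grade p \<psi>\<^sub>2))) *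
    \<omega> (wedge [e i, e j]) (wedge [e k, e l]))"
proof -
  let ?n = "DIM('a)"
  define a where "a i j = ext_vec (e j) * interior (e i) (ext_grade p \<psi>\<^sub>1)" for i j
  define b where "b k l = ext_vec (e l) * interior (e k) (ext_grade p \<psi>\<^sub>2)" for k l
  define w where "w i j k l = \<omega> (wedge [e i, e j]) (wedge [e k, e l])" for i j k l
  define F where "F i j k l = w i j k l * ((2 *\<^sub>R (a i j - a j i)) \<bullet> (2 *\<^sub>R (b k l - b l k)))" for i j k l
  have w1: "w j i k l = - w i j k l" and w2: "w i j l k = - w i j k l" for i j k l
    unfolding w_def wedge_pair_swap[of "e j" "e i"] wedge_pair_swap[of "e l" "e k"]
    by (simp_all only: bilinear_lneg[OF \<omega>] bilinear_rneg[OF \<omega>])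
  have F1: "F j i k l = F i j k l" and F2: "F i j l k = F i j k l" for i j k l
    using w1[of j i k l] w2[of i j l k] by (simp_all add: F_def algebra_simps)
  have "weitzenboeck e p \<omega> \<psi>\<^sub>1 \<psi>\<^sub>2 = 1 / 4 * (\<Sum>j<?n. \<Sum>i<j. \<Sum>l<?n. \<Sum>k<l. F i j k l)"
    unfolding weitzenboeck_def clifford_ad_vec_vec a_def b_def w_def F_def ..
  also have "\<dots> = 1 / 4 * (\<Sum>j<?n. \<Sum>i<j. 1 / 2 * (\<Sum>k<?n. \<Sum>l<?n. F i j k l))"
  proof -
    have "(\<Sum>l<?n. \<Sum>k<l. F i j k l) = 1 / 2 * (\<Sum>k<?n. \<Sum>l<?n. F i j k l)" for i j
      by (rule sum_less_eq_half_sum) (simp_all only: F2, simp add: F_def)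
    then show ?thesis by (simp only:)
  qed
  also have "\<dots> = 1 / 16 * (\<Sum>i<?n. \<Sum>j<?n. \<Sum>k<?n. \<Sum>l<?n. F i j k l)"
  proof -
    have "(\<Sum>j<?n. \<Sum>i<j. 1 / 2 * (\<Sum>k<?n. \<Sum>l<?n. F i j k l)) =
        1 / 2 * (\<Sum>i<?n. \<Sum>j<?n. 1 / 2 * (\<Sum>k<?n. \<Sum>l<?n. F i j k l))"
    proof (rule sum_less_eq_half_sum)
      show "1 / 2 * (\<Sum>k<?n. \<Sum>l<?n. F j i k l) = 1 / 2 * (\<Sum>k<?n. \<Sum>l<?n. F i j k l)" for i j
        by (simp only: F1[of j i])
    qed (simp add: F_def)
    then show ?thesis by (simp add: sum_distrib_left)
  qed
  also have "(\<Sum>i<?n. \<Sum>j<?n. \<Sum>k<?n. \<Sum>l<?n. F i j k l) =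
      4 * (\<Sum>i<?n. \<Sum>j<?n. \<Sum>k<?n. \<Sum>l<?n.
        (a i j \<bullet> b k l - a j i \<bullet> b k l - a i j \<bullet> b l k + a j i \<bullet> b l k) * w i j k l)"
    unfolding sum_distrib_left
    by (intro sum.cong refl) (simp add: F_def algebra_simps)
  also have "(\<Sum>i<?n. \<Sum>j<?n. \<Sum>k<?n. \<Sum>l<?n.
        (a i j \<bullet> b k l - a j i \<bullet> b k l - a i j \<bullet> b l k + a j i \<bullet> b l k) * w i j k l) =
      4 * (\<Sum>i<?n. \<Sum>j<?n. \<Sum>k<?n. \<Sum>l<?n. (a i j \<bullet> b k l) * w i j k l)"
    by (rule sum_antisymmetrize[OF w1 w2])
  finally show ?thesis by (simp add: a_def b_def w_def)
qed

lemma sum_swap_outer: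
  "(\<Sum>j\<in>A. \<Sum>k\<in>B. \<Sum>l\<in>C. g j k l) = (\<Sum>l\<in>C. \<Sum>k\<in>B. \<Sum>j\<in>A. g j k l)"
proof -
  have "(\<Sum>j\<in>A. \<Sum>k\<in>B. \<Sum>l\<in>C. g j k l) = (\<Sum>k\<in>B. \<Sum>j\<in>A. \<Sum>l\<in>C. g j k l)"
    by (rule sum.swap)
  also have "\<dots> = (\<Sum>k\<in>B. \<Sum>l\<in>C. \<Sum>j\<in>A. g j k l)"
    by (rule sum.cong[OF refl], rule sum.swap)
  also have "\<dots> = (\<Sum>l\<in>C. \<Sum>k\<in>B. \<Sum>j\<in>A. g j k l)"
    by (rule sum.swap)
  finally show ?thesis .
qed

text \<open>The first Bianchi identity in the form in which it is used: exchanging \<open>j\<close> and \<open>l\<close> in one factor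
  halves the sum.\<close>

lemma sum_bianchi:
  fixes w T :: "nat \<Rightarrow> nat \<Rightarrow> nat \<Rightarrow> nat \<Rightarrow> real"
  assumes w1: "\<And>i j k l. w j i k l = - w i j k l" and w2: "\<And>i j k l. w i j l k = - w i j k l"
    and sym: "\<And>i j k l. w k l i j = w i j k l"
    and bianchi: "\<And>i j k l. w i j k l + w j k i l + w k i j l = 0"
    and T: "\<And>i j k l. T j i k l = - T i j k l"
  shows "(\<Sum>i<n. \<Sum>j<n. \<Sum>k<n. \<Sum>l<n. w i j k l * T i l k j) =
    1 / 2 * (\<Sum>i<n. \<Sum>j<n. \<Sum>k<n. \<Sum>l<n. w i j k l * T i j k l)" (is "?L = _")
proof -
  have 1: "?L = (\<Sum>i<n. \<Sum>j<n. \<Sum>k<n. \<Sum>l<n. w i l k j * T i j k l)"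
    by (rule sum.cong[OF refl], rule sum_swap_outer)
  also have "\<dots> = (\<Sum>i<n. \<Sum>j<n. \<Sum>k<n. \<Sum>l<n. w j l k i * T j i k l)"
    by (rule sum.swap)
  finally have 2: "?L = (\<Sum>i<n. \<Sum>j<n. \<Sum>k<n. \<Sum>l<n. w j l k i * T j i k l)" .
  \<comment> \<open>Antisymmetrizing \<open>w i l k j\<close> in \<open>i\<close> and \<open>j\<close> gives \<open>w i j k l\<close>.\<close>
  have "w i l k j * T i j k l + w j l k i * T j i k l = w i j k l * T i j k l" for i j k l
  proof -
    have "w i l k j = w j k l i"
      using sym[of i l k j] w1[of j k i l] w2[of j k l i] by simp
    moreover have "w j l k i = - w l j k i" by (rule w1)
    moreover have "w k l j i = - w i j k l"
      using sym[of j i k l] w1[of i j k l] by simp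
    moreover have "w j k l i + w k l j i + w l j k i = 0" by (rule bianchi)
    ultimately have "w i l k j - w j l k i = w i j k l" by simp
    then show ?thesis unfolding T[of j i k l] by (simp flip: left_diff_distrib)
  qed
  then have "?L + ?L = (\<Sum>i<n. \<Sum>j<n. \<Sum>k<n. \<Sum>l<n. w i j k l * T i j k l)"
    by (subst 2, subst 1) (simp flip: sum.distrib)
  then show ?thesis by simp
qed

lemma first_bianchi_2_2:
  assumes "first_bianchi 2 2 \<omega>"
  shows "\<omega> (wedge [x, y]) (wedge [z, u]) = \<omega> (wedge [x, z]) (wedge [y, u]) - \<omega> (wedge [y, z]) (wedge [x, u])"
proof -
  \<comment> \<open>The value \<open>z\<close> at the indices above \<open>2\<close> plays no role.\<close>
  define X where "X = (\<lambda>j :: nat. if j = 0 then x else if j = 1 then y else z)"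
  have "(\<Sum>j<2 + 1. (- 1) ^ Suc j *
      \<omega> (wedge (map X ([0..<j] @ [Suc j..<2 + 1]))) (wedge (X j # map (\<lambda>_. u) [0..<2 - 1]))) = 0"
    using assms unfolding first_bianchi_def by blast
  then show ?thesis
    by (simp add: X_def eval_nat_numeral lessThan_Suc upt_rec)
qed

lemma double_form_dform_prod:
  assumes "bilinear \<omega>\<^sub>1" "double_form r s \<omega>\<^sub>2"
  shows "double_form (p + r) (q + s) (dform_prod p q r s \<omega>\<^sub>1 \<omega>\<^sub>2)"
  unfolding dform_prod_eq_coord[OF orthonormal_basis_ref_basis assms]
  by (rule double_form_prod_coord[OF assms(2)])

lemma sum_inner_mult_orthonormal_basis:
  fixes e :: "nat \<Rightarrow> 'a::euclidean_space"
  assumes "orthonormal_basis e"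
  shows "(\<Sum>i<DIM('a). (e i \<bullet> v) * (e i \<bullet> w)) = v \<bullet> w"
proof -
  have "linear (\<lambda>u. u \<bullet> w)" by (rule linearI) (simp_all add: inner_add_left)
  from sum_orthonormal_basis_linear[OF assms this] show ?thesis by simp
qed

lemma dform_prod_metric_wedge_pair:
  fixes e :: "nat \<Rightarrow> 'a::euclidean_space" and x y z u :: 'a
  assumes e: "orthonormal_basis e" and \<eta>: "double_form 1 1 \<eta>"
  shows "dform_prod 1 1 1 1 dform_metric \<eta> (wedge [x, y]) (wedge [z, u]) =
    (x \<bullet> z) * \<eta> (ext_vec y) (ext_vec u) - (y \<bullet> z) * \<eta> (ext_vec x) (ext_vec u)
    - (x \<bullet> u) * \<eta> (ext_vec y) (ext_vec z) + (y \<bullet> u) * \<eta> (ext_vec x) (ext_vec z)"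
proof -
  note bil = bilinear_double_form[OF \<eta>]
  have "dform_prod 1 1 1 1 dform_metric \<eta> (wedge [x, y]) (wedge [z, u]) = (\<Sum>i<DIM('a).
      (e i \<bullet> x) * (e i \<bullet> z) * \<eta> (ext_vec y) (ext_vec u) - (e i \<bullet> y) * (e i \<bullet> z) * \<eta> (ext_vec x) (ext_vec u)
      - (e i \<bullet> x) * (e i \<bullet> u) * \<eta> (ext_vec y) (ext_vec z) + (e i \<bullet> y) * (e i \<bullet> u) * \<eta> (ext_vec x) (ext_vec z))"
    unfolding dform_prod_metric[OF e \<eta>] interior_wedge_pair
    by (simp add: bilinear_lsub[OF bil] bilinear_rsub[OF bil] bilinear_lmul[OF bil] bilinear_rmul[OF bil]
        algebra_simps)
  also have "\<dots> = (x \<bullet> z) * \<eta> (ext_vec y) (ext_vec u) - (y \<bullet> z) * \<eta> (ext_vec x) (ext_vec u)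
    - (x \<bullet> u) * \<eta> (ext_vec y) (ext_vec z) + (y \<bullet> u) * \<eta> (ext_vec x) (ext_vec z)"
    by (simp only: sum.distrib sum_subtractf sum_inner_mult_orthonormal_basis[OF e] flip: sum_distrib_right)
  finally show ?thesis .
qed

lemma sum_inner_mult_select:
  fixes e :: "nat \<Rightarrow> 'a::euclidean_space"
  assumes "orthonormal_basis e" "i < DIM('a)"
  shows "(\<Sum>k<DIM('a). (e i \<bullet> e k) * h k) = h i"
proof -
  have "(\<Sum>k<DIM('a). (e i \<bullet> e k) * h k) = (\<Sum>k<DIM('a). if k = i then h k else 0)"
    using assms(2) by (intro sum.cong refl) (simp add: orthonormal_basis_inner[OF assms(1)])
  then show ?thesis using assms(2) by simp
qed

theorem theorem3p1:
  fixes \<omega> :: "'a::euclidean_space dform"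
    and e f :: "nat \<Rightarrow> 'a"
    and p :: nat
  assumes "orthonormal_basis e" and "orthonormal_basis f"
    and "double_form 2 2 \<omega>"
    and "symmetric_dform \<omega>"
    and "first_bianchi 2 2 \<omega>"
    and "2 \<le> p" and "p + 2 \<le> DIM('a)"
  shows "weitzenboeck e p \<omega> =
    dform_prod 2 2 (p - 2) (p - 2)
      (\<lambda>\<phi> \<psi>. dform_prod 1 1 1 1 dform_metric (contraction f \<omega>) \<phi> \<psi> / (real p - 1) - 2 * \<omega> \<phi> \<psi>)
      (\<lambda>\<phi> \<psi>. dform_metric_pow (p - 2) \<phi> \<psi> / fact (p - 2))"
proof (intro HOL.ext)
  fix \<psi>\<^sub>1 \<psi>\<^sub>2 :: "'a ext"
  let ?n = "DIM('a)"
  note e = assms(1) and bil = bilinear_double_form[OF assms(3)]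
  obtain q where p: "p = Suc (Suc q)"
    using assms(6) by (metis add_2_eq_Suc le_Suc_ex)
  define \<phi> where "\<phi> = ext_grade p \<psi>\<^sub>1"
  define \<psi> where "\<psi> = ext_grade p \<psi>\<^sub>2"
  \<comment> \<open>The components of \<open>\<omega>\<close> and \<open>c\<omega>\<close>, and the inner products of simple and of double interior products.\<close>
  define w where "w i j k l = \<omega> (wedge [e i, e j]) (wedge [e k, e l])" for i j k l
  define C where "C i k = contraction e \<omega> (ext_vec (e i)) (ext_vec (e k))" for i k
  define T where "T i j k l = interior (e j) (interior (e i) \<phi>) \<bullet> interior (e l) (interior (e k) \<psi>)"
    for i j k l
  define X where "X i k = interior (e i) \<phi> \<bullet> interior (e k) \<psi>" for i k
  have w1: "w j i k l = - w i j k l" and w2: "w i j l k = - w i j k l" for i j k l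
    unfolding w_def wedge_pair_swap[of "e j" "e i"] wedge_pair_swap[of "e l" "e k"]
    by (simp_all only: bilinear_lneg[OF bil] bilinear_rneg[OF bil])
  have sym: "w k l i j = w i j k l" for i j k l
    using assms(4) unfolding w_def symmetric_dform_def by blast
  have bianchi: "w i j k l + w j k i l + w k i j l = 0" for i j k l
    using first_bianchi_2_2[OF assms(5), of "e i" "e j" "e k" "e l"] w1[of k i j l]
    by (simp add: w_def)
  have T1: "T j i k l = - T i j k l" and T2: "T i j l k = - T i j k l" for i j k l
    unfolding T_def interior_anticommute[of "e i" "e j"] interior_anticommute[of "e k" "e l"]
    by simp_all
  have C: "C i k = (\<Sum>m<?n. w i m k m)" for i k
  proof -
    have "\<omega> (wedge [e m, e i]) (wedge [e m, e k]) = w i m k m" for m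
      using w1[of m i m k] w2[of i m m k] by (simp add: w_def)
    then show ?thesis by (simp add: C_def contraction_def)
  qed
  have "weitzenboeck e p \<omega> \<psi>\<^sub>1 \<psi>\<^sub>2 = (\<Sum>i<?n. \<Sum>j<?n. \<Sum>k<?n. \<Sum>l<?n.
      ((e j \<bullet> e l) * X i k - T i l k j) * w i j k l)"
    unfolding weitzenboeck_eq_sum[OF bil] inner_vec_mult_interior w_def X_def T_def \<phi>_def \<psi>_def ..
  also have "\<dots> = (\<Sum>i<?n. \<Sum>j<?n. \<Sum>k<?n. \<Sum>l<?n. (e j \<bullet> e l) * (X i k * w i j k l)) -
      (\<Sum>i<?n. \<Sum>j<?n. \<Sum>k<?n. \<Sum>l<?n. T i l k j * w i j k l)"
    by (simp only: left_diff_distrib sum_subtractf mult.assoc)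
  also have "(\<Sum>i<?n. \<Sum>j<?n. \<Sum>k<?n. \<Sum>l<?n. (e j \<bullet> e l) * (X i k * w i j k l)) =
      (\<Sum>i<?n. \<Sum>j<?n. \<Sum>k<?n. X i k * w i j k j)"
    by (intro sum.cong refl) (simp add: sum_inner_mult_select[OF e])
  also have "\<dots> = (\<Sum>i<?n. \<Sum>k<?n. \<Sum>j<?n. X i k * w i j k j)"
    by (rule sum.cong[OF refl], rule sum.swap)
  also have "\<dots> = (\<Sum>i<?n. \<Sum>k<?n. C i k * X i k)"
    by (simp add: C sum_distrib_left mult.commute)
  also have "(\<Sum>i<?n. \<Sum>j<?n. \<Sum>k<?n. \<Sum>l<?n. T i l k j * w i j k l) =
      1 / 2 * (\<Sum>i<?n. \<Sum>j<?n. \<Sum>k<?n. \<Sum>l<?n. w i j k l * T i j k l)"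
    using sum_bianchi[where w = w and T = T and n = "DIM('a)", OF w1 w2 sym bianchi T1] by (simp only: mult.commute)
  finally have lhs: "weitzenboeck e p \<omega> \<psi>\<^sub>1 \<psi>\<^sub>2 = (\<Sum>i<?n. \<Sum>k<?n. C i k * X i k) -
      1 / 2 * (\<Sum>i<?n. \<Sum>j<?n. \<Sum>k<?n. \<Sum>l<?n. w i j k l * T i j k l)" .

  define h where "h = dform_prod 1 1 1 1 dform_metric (contraction e \<omega>)"
  define \<Omega> where "\<Omega> = (\<lambda>\<phi> \<psi>. h \<phi> \<psi> / (real p - 1) - 2 * \<omega> \<phi> \<psi>)"
  have c: "double_form 1 1 (contraction e \<omega>)"
    using double_form_contraction[of 1 1 \<omega> e] assms(3) by (simp add: numeral_2_eq_2)
  have "bilinear h"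
    unfolding h_def dform_metric_eq_inner
    by (rule bilinear_double_form[OF double_form_dform_prod[OF bilinear_double_form[OF double_form_inner] c]])
  then have \<Omega>: "bilinear \<Omega>"
    using bil unfolding \<Omega>_def bilinear_def linear_iff
    by (simp add: algebra_simps add_divide_distrib)
  have hw: "h (wedge [e i, e j]) (wedge [e k, e l]) =
      (e i \<bullet> e k) * C j l - (e j \<bullet> e k) * C i l - (e i \<bullet> e l) * C j k + (e j \<bullet> e l) * C i k" for i j k l
    unfolding h_def C_def by (rule dform_prod_metric_wedge_pair[OF e c])
  \<comment> \<open>The term in \<open>g c\<omega>\<close>: summation over \<open>i\<close> gives the degree \<open>p - 1\<close> of \<open>\<iota>\<^sub>l\<psi>\<close>, which cancels the denominator.\<close>
  have "(\<Sum>i<?n. \<Sum>j<?n. \<Sum>k<?n. \<Sum>l<?n. h (wedge [e i, e j]) (wedge [e k, e l]) * T i j k l) =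
      4 * (\<Sum>i<?n. \<Sum>j<?n. \<Sum>k<?n. \<Sum>l<?n. (e i \<bullet> e k) * C j l * T i j k l)"
    unfolding hw by (rule sum_antisymmetrize[where A = "\<lambda>i j k l. (e i \<bullet> e k) * C j l", OF T1 T2])
  also have "(\<Sum>i<?n. \<Sum>j<?n. \<Sum>k<?n. \<Sum>l<?n. (e i \<bullet> e k) * C j l * T i j k l) =
      (\<Sum>i<?n. \<Sum>j<?n. \<Sum>l<?n. \<Sum>k<?n. (e i \<bullet> e k) * (C j l * T i j k l))"
    unfolding mult.assoc by (rule sum.cong[OF refl], rule sum.cong[OF refl], rule sum.swap)
  also have "\<dots> = (\<Sum>i<?n. \<Sum>j<?n. \<Sum>l<?n. C j l * T i j i l)"
    by (intro sum.cong refl) (simp add: sum_inner_mult_select[OF e])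
  also have "\<dots> = (\<Sum>j<?n. \<Sum>i<?n. \<Sum>l<?n. C j l * T i j i l)"
    by (rule sum.swap)
  also have "\<dots> = (\<Sum>j<?n. \<Sum>l<?n. \<Sum>i<?n. C j l * T i j i l)"
    by (rule sum.cong[OF refl], rule sum.swap)
  also have "\<dots> = (real p - 1) * (\<Sum>j<?n. \<Sum>l<?n. C j l * X j l)"
  proof -
    have "(\<Sum>i<?n. T i j i l) = (real p - 1) * X j l" for j l
    proof -
      have "T i j i l = ext_grade q (interior (e i) (interior (e j) \<psi>\<^sub>1)) \<bullet>
          ext_grade q (interior (e i) (interior (e l) \<psi>\<^sub>2))" for i
        unfolding T_def interior_anticommute[of "e j" "e i"] interior_anticommute[of "e l" "e i"]
        by (simp add: \<phi>_def \<psi>_def p ext_grade_interior)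
      then have "(\<Sum>i<?n. T i j i l) = real (Suc q) *
          (ext_grade (Suc q) (interior (e j) \<psi>\<^sub>1) \<bullet> ext_grade (Suc q) (interior (e l) \<psi>\<^sub>2))"
        by (simp only: sum_inner_interior[OF e])
      then show ?thesis by (simp add: X_def \<phi>_def \<psi>_def p ext_grade_interior)
    qed
    then show ?thesis
      by (simp only: sum_distrib_left[symmetric]) (simp add: sum_distrib_left mult.left_commute)
  qed
  finally have hT: "(\<Sum>i<?n. \<Sum>j<?n. \<Sum>k<?n. \<Sum>l<?n. h (wedge [e i, e j]) (wedge [e k, e l]) * T i j k l) =
      4 * ((real p - 1) * (\<Sum>j<?n. \<Sum>l<?n. C j l * X j l))" .

  have "dform_prod 2 2 q q \<Omega> (dform_inner q) \<psi>\<^sub>1 \<psi>\<^sub>2 = 1 / 4 * (\<Sum>i<?n. \<Sum>j<?n. \<Sum>k<?n. \<Sum>l<?n.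
      \<Omega> (wedge [e i, e j]) (wedge [e k, e l]) * T i j k l)"
    unfolding dform_prod_eq_coord[OF e \<Omega> double_form_inner] dform_prod_coord_2
    by (simp add: dform_inner_def T_def \<phi>_def \<psi>_def p ext_grade_interior)
  also have "\<dots> = 1 / (4 * (real p - 1)) *
        (\<Sum>i<?n. \<Sum>j<?n. \<Sum>k<?n. \<Sum>l<?n. h (wedge [e i, e j]) (wedge [e k, e l]) * T i j k l) -
      1 / 2 * (\<Sum>i<?n. \<Sum>j<?n. \<Sum>k<?n. \<Sum>l<?n. w i j k l * T i j k l)"
    unfolding \<Omega>_def w_def sum_distrib_left sum_subtractf[symmetric]
    by (intro sum.cong refl) (simp add: algebra_simps)
  also have "\<dots> = weitzenboeck e p \<omega> \<psi>\<^sub>1 \<psi>\<^sub>2"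
  proof -
    have cancel: "1 / (4 * r) * (4 * (r * s)) = s" if "r \<noteq> 0" for r s :: real
      using that by simp
    have "real p - 1 \<noteq> 0" using p by simp
    then show ?thesis unfolding hT lhs by (simp only: cancel[OF \<open>real p - 1 \<noteq> 0\<close>])
  qed
  finally have "weitzenboeck e p \<omega> \<psi>\<^sub>1 \<psi>\<^sub>2 = dform_prod 2 2 q q \<Omega> (dform_inner q) \<psi>\<^sub>1 \<psi>\<^sub>2" ..
  moreover have "(\<lambda>\<phi> \<psi>. dform_metric_pow (p - 2) \<phi> \<psi> / fact (p - 2)) = (dform_inner q :: 'a dform)"
    by (intro HOL.ext) (simp add: dform_metric_pow_eq p)
  moreover have "contraction f \<omega> = contraction e \<omega>"
    by (rule contraction_orthonormal_basis[OF e assms(2) bil])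
  ultimately show "weitzenboeck e p \<omega> \<psi>\<^sub>1 \<psi>\<^sub>2 = dform_prod 2 2 (p - 2) (p - 2)
      (\<lambda>\<phi> \<psi>. dform_prod 1 1 1 1 dform_metric (contraction f \<omega>) \<phi> \<psi> / (real p - 1) - 2 * \<omega> \<phi> \<psi>)
      (\<lambda>\<phi> \<psi>. dform_metric_pow (p - 2) \<phi> \<psi> / fact (p - 2)) \<psi>\<^sub>1 \<psi>\<^sub>2"
    by (simp add: \<Omega>_def h_def p)
qed

end
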